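(* Assume: (1) there exist $w_0\in\mathcal K$ and $\epsilon_0\ge 0$ such that $F(w_0)-F_*\le\epsilon_0$; (2) there is a constant $G$ such that $\|\partial f(w;\xi)\|_2\le G$; (3) for a target accuracy $\epsilon\ll1$ there are constants $c>0$ and $\theta\in(0,1]$ such that $\|w-w_*\|_2\le c\,(F(w)-F_* )^{\theta}$ for all $w\in\mathcal S_\epsilon$, where $w_*$ is the point of $\mathcal K_*$ closest to $w$. Given $\delta\in(0,1/e)$, let $\tilde\delta=\delta/K$, $K=\lceil\log_2(\epsilon_0/\epsilon)\rceil$, $\beta_1\ge\frac{2c^2\epsilon_0}{\epsilon^{2(1-\theta)}}$, and let $t$ be the smallest integer such that $$t\ \ge\ \max\left\{3,\ \frac{136\,\beta_1G^2\,\big(1+\log(4\log t/\tilde\delta)+\log t\big)}{\epsilon_0}\right\}.$$ Then ASSG-r (with inputs $w_0,K,t,\epsilon_0,\beta_1$) guarantees that, with probability $1-\delta$, $$F(w_K)-F_*\le2\epsilon .$$ As a result, the iteration complexity of ASSG-r for achieving a $2\epsilon$-optimal solution with high probability $1-\delta$ is $$O\left(\frac{c^2G^2\,\lceil\log_2(\epsilon_0/\epsilon)\rceil\,\log(1/\delta)}{\epsilon^{2(1-\theta)}}\right),$$ provided $\beta_1=O\big(\frac{2c^2\epsilon_0}{\epsilon^{2(1-\theta)}}\big)$.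
   Context: Setting: $\mathcal K\subseteq\mathbb R^d$ is a closed convex set, $\xi$ is a random variable, $f(w;\xi)$ is a convex function of $w$, $F(w)=\mathbb E_\xi[f(w;\xi)]$, $F_*=\min_{w\in\mathcal K}F(w)$, and $\mathcal K_*=\arg\min_{w\in\mathcal K}F(w)$ is the (nonempty) optimal set. $\partial f(w;\xi)$ denotes a subgradient of $f(\cdot;\xi)$ at $w$. $\mathcal S_\epsilon=\{w\in\mathcal K:F(w)\le F_*+\epsilon\}$. $\Pi_{\mathcal K}$ is Euclidean projection onto $\mathcal K$. A point $w$ is $2\epsilon$-optimal if $F(w)-F_*\le2\epsilon$. Algorithm ASSG-r: For $k=1,\dots,K$: let $w_1^k=w_{k-1}$; for $\tau=1,\dots,t-1$ let $w'_{\tau+1}=(1-\frac2\tau)w^k_\tau+\frac2\tau w^k_1-\frac{2\beta_k}{\tau}\partial f(w^k_\tau;\xi^k_\tau)$ and $w^k_{\tau+1}=\Pi_{\mathcal K}[w'_{\tau+1}]$, where the $\xi^k_\tau$ are independent samples of $\xi$; let $w_k=\frac1t\sum_{\tau=1}^tw^k_\tau$ and $\beta_{k+1}=\beta_k/2$. Output $w_K$.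
   Formalization: The O-bound, false as written since t contains log t and log K, gets the extra factor 1+log(K·R)/log(1/δ), R=c²G²/ε^{2(1-θ)}, with K·t as iteration count; this clause also assumes S_ε is not all of 𝒦 (otherwise G=0 breaks it). *)

theory Defs
  imports "HOL-Probability.Probability"
begin

section \<open>Stochastic convex optimisation\<close>

text \<open>The random datum \<open>\<xi>\<close> is represented by its law \<open>D\<close>.\<close>

definition expected_loss :: "'s measure \<Rightarrow> ('a \<Rightarrow> 's \<Rightarrow> real) \<Rightarrow> 'a \<Rightarrow> real" where
  "expected_loss D f w = (\<integral>x. f w x \<partial>D)"

definition optimal_set :: "('a \<Rightarrow> real) \<Rightarrow> 'a set \<Rightarrow> 'a set" where
  "optimal_set F W = {w. is_arg_min F (\<lambda>v. v \<in> W) w}"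

text \<open>A minimum whenever the optimal set is nonempty, which is assumed below.\<close>

definition optimal_value :: "('a \<Rightarrow> real) \<Rightarrow> 'a set \<Rightarrow> real" where
  "optimal_value F W = (INF w\<in>W. F w)"

definition sublevel :: "('a \<Rightarrow> real) \<Rightarrow> 'a set \<Rightarrow> real \<Rightarrow> 'a set" where
  "sublevel F W e = {w \<in> W. F w \<le> optimal_value F W + e}"

text \<open>Subgradient of a function considered on \<open>W\<close> only. A subgradient of a convex function
  on the whole space is in particular one relative to \<open>W\<close>.\<close>

definition is_subgradient_on :: "'a::euclidean_space set \<Rightarrow> ('a \<Rightarrow> real) \<Rightarrow> 'a \<Rightarrow> 'a \<Rightarrow> bool" where
  "is_subgradient_on W h w v \<longleftrightarrow> (\<forall>y\<in>W. h y \<ge> h w + v \<bullet> (y - w))"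

section \<open>ASSG-r\<close>

text \<open>\<open>inner_iterate W g \<beta> w\<^sub>1 x \<tau>\<close> is the iterate with index \<open>\<tau> \<ge> 1\<close> of one stage started at
  \<open>w\<^sub>1\<close>, using the samples \<open>x 1, \<dots>, x (\<tau> - 1)\<close>; the value at index 0 plays no role.\<close>

primrec inner_iterate ::
  "'a::euclidean_space set \<Rightarrow> ('a \<Rightarrow> 's \<Rightarrow> 'a) \<Rightarrow> real \<Rightarrow> 'a \<Rightarrow> (nat \<Rightarrow> 's) \<Rightarrow> nat \<Rightarrow> 'a" where
  "inner_iterate W g \<beta> w1 x 0 = w1"
| "inner_iterate W g \<beta> w1 x (Suc \<tau>) =
     (if \<tau> = 0 then w1
      else let w = inner_iterate W g \<beta> w1 x \<tau>
           in closest_point W ((1 - 2 / real \<tau>) *\<^sub>R w + (2 / real \<tau>) *\<^sub>R w1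
                - (2 * \<beta> / real \<tau>) *\<^sub>R g w (x \<tau>)))"

text \<open>\<open>assg_r W g t \<beta>1 w0 x k\<close> is the output of stage \<open>k\<close>; stage \<open>k + 1\<close> runs with parameter
  \<open>\<beta>1 / 2 ^ k\<close>, and \<open>x k \<tau>\<close> is the sample drawn in stage \<open>k\<close> at step \<open>\<tau>\<close>.\<close>

primrec assg_r ::
  "'a::euclidean_space set \<Rightarrow> ('a \<Rightarrow> 's \<Rightarrow> 'a) \<Rightarrow> nat \<Rightarrow> real \<Rightarrow> 'a \<Rightarrow> (nat \<Rightarrow> nat \<Rightarrow> 's) \<Rightarrow> nat \<Rightarrow> 'a"
where
  "assg_r W g t \<beta>1 w0 x 0 = w0"
| "assg_r W g t \<beta>1 w0 x (Suc k) =
     (1 / real t) *\<^sub>R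
       (\<Sum>\<tau>=1..t. inner_iterate W g (\<beta>1 / 2 ^ k) (assg_r W g t \<beta>1 w0 x k) (x (Suc k)) \<tau>)"

text \<open>If \<open>\<epsilon>0 \<le> \<epsilon>\<close>, then there are no stages and the output is \<open>w0\<close>.\<close>

definition num_stages :: "real \<Rightarrow> real \<Rightarrow> nat" where
  "num_stages \<epsilon>0 \<epsilon> = nat \<lceil>log 2 (\<epsilon>0 / \<epsilon>)\<rceil>"

definition stage_length :: "real \<Rightarrow> real \<Rightarrow> real \<Rightarrow> real \<Rightarrow> nat" where
  "stage_length G \<epsilon>0 \<beta>1 \<delta>' = (LEAST t::nat. real t \<ge>
     max 3 (136 * \<beta>1 * G\<^sup>2 * (1 + ln (4 * ln (real t) / \<delta>') + ln (real t)) / \<epsilon>0))"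

section \<open>Standing assumptions\<close>

locale stochastic_convex_problem = prob_space D
  for D :: "'s measure" +
  fixes W :: "'a::euclidean_space set"
    and f :: "'a \<Rightarrow> 's \<Rightarrow> real"
    and g :: "'a \<Rightarrow> 's \<Rightarrow> 'a"
  assumes closed_W: "closed W"
    and convex_W: "convex W"
    and convex_f: "\<And>x. x \<in> space D \<Longrightarrow> convex_on W (\<lambda>w. f w x)"
    and integrable_f: "\<And>w. w \<in> W \<Longrightarrow> integrable D (f w)"
    and optimal_set_nonempty: "optimal_set (expected_loss D f) W \<noteq> {}"
    and subgradient_g: "\<And>w x. w \<in> W \<Longrightarrow> x \<in> space D \<Longrightarrow>
          is_subgradient_on W (\<lambda>v. f v x) w (g w x)"
    and measurable_g: "(\<lambda>(w, x). g w x) \<in> borel_measurable (borel \<Otimes>\<^sub>M D)"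

locale assg_r_setting =
  stochastic_convex_problem D W f g + samples: prob_space M
  for M :: "'m measure"
    and D :: "'s measure"
    and W :: "'a::euclidean_space set"
    and f :: "'a \<Rightarrow> 's \<Rightarrow> real"
    and g :: "'a \<Rightarrow> 's \<Rightarrow> 'a" +
  fixes w0 :: 'a
    and \<epsilon>0 G \<epsilon> c \<theta> \<delta> \<beta>1 :: real
    and \<xi> :: "nat \<Rightarrow> nat \<Rightarrow> 'm \<Rightarrow> 's"
    and F :: "'a \<Rightarrow> real"
    and K t :: nat
  assumes F_eq: "F = expected_loss D f"
    and w0_in_W: "w0 \<in> W"
    and \<epsilon>0_nonneg: "\<epsilon>0 \<ge> 0"
    and initial_gap: "F w0 - optimal_value F W \<le> \<epsilon>0"
    and subgradient_bound: "\<And>w x. w \<in> W \<Longrightarrow> x \<in> space D \<Longrightarrow> norm (g w x) \<le> G"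
    and \<epsilon>_pos: "\<epsilon> > 0"
    and c_pos: "c > 0"
    and \<theta>_pos: "\<theta> > 0"
    and \<theta>_le_1: "\<theta> \<le> 1"
    and local_error_bound: "\<And>w. w \<in> sublevel F W \<epsilon> \<Longrightarrow>
          norm (w - closest_point (optimal_set F W) w) \<le> c * (F w - optimal_value F W) powr \<theta>"
    and \<delta>_pos: "\<delta> > 0"
    and \<delta>_less: "\<delta> < 1 / exp 1"
    and K_eq: "K = num_stages \<epsilon>0 \<epsilon>"
    and \<beta>1_ge: "\<beta>1 \<ge> 2 * c\<^sup>2 * \<epsilon>0 / \<epsilon> powr (2 * (1 - \<theta>))"
    and t_eq: "t = stage_length G \<epsilon>0 \<beta>1 (\<delta> / real K)"
    and indep_samples: "prob_space.indep_vars M (\<lambda>_. D) (\<lambda>(k, \<tau>). \<xi> k \<tau>) ({1..K} \<times> {1..<t})"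
    and distr_samples: "\<And>k \<tau>. k \<in> {1..K} \<Longrightarrow> \<tau> \<in> {1..<t} \<Longrightarrow> distr M D (\<xi> k \<tau>) = D"

end

theory Submission
  imports Defs "HOL-Real_Asymp.Real_Asymp"
begin

text \<open>
  Write \<open>F\<^sub>*\<close> for the optimal value. The invariant is that after \<open>k\<close> stages the gap \<open>F - F\<^sub>*\<close> is
  at most \<open>\<epsilon> + \<epsilon>0 / 2\<^sup>k\<close>; after \<open>K\<close> stages this is at most \<open>2 \<epsilon>\<close>.

  The error bound is assumed only on the set of \<open>\<epsilon>\<close>-optimal points. Convexity extrapolates
  it (\<open>dist_sublevel_le\<close>): on the segment from a point \<open>w\<close> to its nearest minimiser the loss
  climbs by \<open>\<epsilon>\<close> within a distance \<open>c \<epsilon>\<^sup>\<theta>\<close>, and beyond that point it climbs at least as fast. Hence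
  the distance from \<open>w\<close> to the \<open>\<epsilon>\<close>-optimal set is linear in the gap of \<open>w\<close>, and the nearest
  \<open>\<epsilon>\<close>-optimal point \<open>u\<close> is a comparator that the stage can reach.

  A stage started at \<open>w1\<close> is the stochastic subgradient method for the regularised loss
  \<open>F w + |w - w1|\<^sup>2 / (2 \<beta>)\<close>. The step sizes \<open>2 \<beta> / \<tau>\<close> are twice as long as those for which strong
  convexity makes the squared distances telescope exactly. Half of the strong convexity is
  therefore left over, in the form of a negative term \<open>- |w\<^sub>\<tau> - u|\<^sup>2 / (4 \<beta>)\<close> at each iterate
  (\<open>stage_average_le\<close>).

  These leftovers make the deviation estimate short. The noise at an iterate has conditional mean
  zero and a range proportional to \<open>G |w\<^sub>\<tau> - u|\<close>, so by Hoeffding's lemma its conditional exponential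
  moment with a small exponent is cancelled by the leftover. The compensated sum is thus an
  exponential supermartingale (\<open>nn_integral_exp_compensated_noise_le_1\<close>) with an exponent of order
  \<open>1 / (\<beta> G\<^sup>2)\<close>, and Chernoff's bound applies to it directly. The chosen stage length makes the
  failure probability of each stage at most \<open>\<delta> / K\<close>, and a union bound over the stages concludes.

  For the complexity, a set of \<open>\<epsilon>\<close>-optimal points other than \<open>W\<close> forces the condition number
  \<open>c\<^sup>2 G\<^sup>2 / \<epsilon> powr (2 (1 - \<theta>))\<close> to be at least 1 (\<open>condition_number_ge_1\<close>): the loss cannot fall by
  \<open>\<epsilon>\<close> over the distance \<open>c \<epsilon>\<^sup>\<theta>\<close> if its slope \<open>G\<close> is smaller. The implicit inequality for the stage
  length can then be solved up to a constant factor.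
\<close>

section \<open>Convex sets, segments and sublevel sets\<close>

text \<open>The triangle inequality: since \<open>u\<close> lies between \<open>v\<close> and \<open>w\<close>, a point of \<open>S\<close> closer to
  \<open>u\<close> than \<open>v\<close> is would also be closer to \<open>w\<close>.\<close>

lemma dist_segment_to_closest_point:
  fixes w v u z :: "'a::real_normed_vector"
  assumes v_nearest: "\<And>y. y \<in> S \<Longrightarrow> norm (w - v) \<le> norm (w - y)"
    and "z \<in> S" and "0 \<le> s" and "s \<le> 1" and u: "u = v + s *\<^sub>R (w - v)"
  shows "norm (u - v) \<le> norm (u - z)"
proof -
  have "w - u = (1 - s) *\<^sub>R (w - v)" "u - v = s *\<^sub>R (w - v)"
    unfolding u by (simp_all add: algebra_simps)
  then have "norm (w - u) + norm (u - v) = norm (w - v)"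
    using \<open>0 \<le> s\<close> \<open>s \<le> 1\<close> by (simp add: left_diff_distrib)
  also have "\<dots> \<le> norm (w - z)"
    using v_nearest \<open>z \<in> S\<close> .
  also have "\<dots> \<le> norm (w - u) + norm (u - z)"
    using norm_triangle_ineq[of "w - u" "u - z"] by simp
  finally show ?thesis by simp
qed

section \<open>The population problem\<close>

context stochastic_convex_problem
begin

abbreviation pop_loss :: "'a \<Rightarrow> real" where
  "pop_loss \<equiv> expected_loss D f"

definition mean_subgradient :: "'a \<Rightarrow> 'a" where
  "mean_subgradient w = (\<integral>x. g w x \<partial>D)"

lemma measurable_g_slice: "g w \<in> borel_measurable D"
  using measurable_compose[OF measurable_Pair1' measurable_g, of w] by simp

lemma measurable_g_compose:
  assumes "v \<in> borel_measurable N" "X \<in> measurable N D"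
  shows "(\<lambda>p. g (v p) (X p)) \<in> borel_measurable N"
  using measurable_compose[OF measurable_Pair[OF assms] measurable_g] by simp

lemma measurable_mean_subgradient: "mean_subgradient \<in> borel_measurable borel"
  unfolding mean_subgradient_def
  by (rule borel_measurable_lebesgue_integral) (use measurable_g in simp)

lemma integrable_g:
  assumes "\<And>x. x \<in> space D \<Longrightarrow> norm (g w x) \<le> G"
  shows "integrable D (g w)"
  using assms by (intro integrable_const_bound[where B = G] measurable_g_slice) auto

lemma norm_mean_subgradient_le:
  assumes "\<And>x. x \<in> space D \<Longrightarrow> norm (g w x) \<le> G"
  shows "norm (mean_subgradient w) \<le> G"
proof -
  have "norm (mean_subgradient w) \<le> (\<integral>x. norm (g w x) \<partial>D)"
    unfolding mean_subgradient_def by (rule integral_norm_bound)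
  also have "\<dots> \<le> (\<integral>x. G \<partial>D)"
    using integrable_g[OF assms] assms by (intro integral_mono) auto
  finally show ?thesis by (simp add: prob_space)
qed

lemma mean_subgradient_is_subgradient:
  assumes "w \<in> W" "y \<in> W" and bound: "\<And>x. x \<in> space D \<Longrightarrow> norm (g w x) \<le> G"
  shows "pop_loss y \<ge> pop_loss w + mean_subgradient w \<bullet> (y - w)"
proof -
  note int = integrable_f[OF \<open>w \<in> W\<close>] integrable_f[OF \<open>y \<in> W\<close>] integrable_g[OF bound]
  have "pop_loss w + mean_subgradient w \<bullet> (y - w) = (\<integral>x. f w x + g w x \<bullet> (y - w) \<partial>D)"
    using int by (simp add: expected_loss_def mean_subgradient_def)
  also have "\<dots> \<le> pop_loss y"
    unfolding expected_loss_def
    using int subgradient_g[OF \<open>w \<in> W\<close>] \<open>y \<in> W\<close>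
    by (intro integral_mono) (auto simp: is_subgradient_on_def)
  finally show ?thesis .
qed

lemma convex_pop_loss: "convex_on W pop_loss"
proof (intro convex_onI convex_W)
  fix r :: real and y z assume r: "0 < r" "r < 1" and "y \<in> W" "z \<in> W"
  let ?m = "(1 - r) *\<^sub>R y + r *\<^sub>R z"
  have "?m \<in> W"
    using convexD_alt[OF convex_W \<open>y \<in> W\<close> \<open>z \<in> W\<close>, of r] r by simp
  then have "pop_loss ?m \<le> (\<integral>x. (1 - r) * f y x + r * f z x \<partial>D)"
    unfolding expected_loss_def
    using convex_onD[OF convex_f, of _ r y z] r \<open>y \<in> W\<close> \<open>z \<in> W\<close> integrable_f
    by (intro integral_mono) auto
  then show "pop_loss ?m \<le> (1 - r) * pop_loss y + r * pop_loss z"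
    using integrable_f \<open>y \<in> W\<close> \<open>z \<in> W\<close> by (simp add: expected_loss_def)
qed

lemma optimal_set_altdef: "optimal_set pop_loss W = sublevel pop_loss W 0"
  and optimal_value_le: "w \<in> W \<Longrightarrow> optimal_value pop_loss W \<le> pop_loss w"
  and minimizer_exists: "\<exists>v\<in>W. pop_loss v = optimal_value pop_loss W"
proof -
  obtain v where v: "v \<in> W" "\<And>y. y \<in> W \<Longrightarrow> pop_loss v \<le> pop_loss y"
    using optimal_set_nonempty by (auto simp: optimal_set_def is_arg_min_def not_less)
  then have opt: "optimal_value pop_loss W = pop_loss v"
    unfolding optimal_value_def
    by (intro cInf_eq_minimum[where z = "pop_loss v"]) auto
  show "w \<in> W \<Longrightarrow> optimal_value pop_loss W \<le> pop_loss w"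
    using opt v by simp
  show "\<exists>v\<in>W. pop_loss v = optimal_value pop_loss W"
    using opt v by auto
  show "optimal_set pop_loss W = sublevel pop_loss W 0"
    unfolding optimal_set_def sublevel_def is_arg_min_def opt
    using v by (auto simp: not_less) (meson order.trans)
qed

end

text \<open>Convexity yields continuity only in the relative interior of \<open>W\<close>. Uniformly bounded
  subgradients make the population loss Lipschitz up to the boundary, which gives closed sublevel
  sets and crossings of intermediate levels.\<close>

locale bounded_subgradient_problem = stochastic_convex_problem D W f g
  for D :: "'s measure" and W :: "'a::euclidean_space set" and f g +
  fixes G :: real
  assumes norm_g_le: "\<And>w x. w \<in> W \<Longrightarrow> x \<in> space D \<Longrightarrow> norm (g w x) \<le> G"
begin

lemma W_nonempty: "W \<noteq> {}"
  using minimizer_exists by blast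

lemma G_nonneg: "G \<ge> 0"
proof -
  obtain w x where "w \<in> W" "x \<in> space D"
    using W_nonempty not_empty by blast
  then show ?thesis
    using norm_g_le[of w x] norm_ge_zero[of "g w x"] by linarith
qed

lemma pop_loss_lipschitz:
  assumes "w \<in> W" "y \<in> W"
  shows "pop_loss w - pop_loss y \<le> G * norm (w - y)"
proof -
  have "pop_loss w - pop_loss y \<le> mean_subgradient w \<bullet> (w - y)"
    using mean_subgradient_is_subgradient[OF assms norm_g_le] assms
    by (simp add: inner_diff_right algebra_simps)
  also have "\<dots> \<le> norm (mean_subgradient w) * norm (w - y)"
    by (rule norm_cauchy_schwarz)
  also have "\<dots> \<le> G * norm (w - y)"
    using norm_mean_subgradient_le norm_g_le assms by (intro mult_right_mono) auto
  finally show ?thesis .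
qed

lemma continuous_pop_loss: "continuous_on W pop_loss"
proof -
  have "G-lipschitz_on W pop_loss"
  proof (rule lipschitz_onI)
    show "dist (pop_loss w) (pop_loss y) \<le> G * dist w y" if "w \<in> W" "y \<in> W" for w y
      using pop_loss_lipschitz[OF that] pop_loss_lipschitz[OF that(2,1)]
      by (simp add: dist_norm abs_le_iff norm_minus_commute)
  qed (rule G_nonneg)
  then show ?thesis by (rule lipschitz_on_continuous_on)
qed

lemma closed_sublevel: "closed (sublevel pop_loss W e)"
proof -
  have "sublevel pop_loss W e = W \<inter> pop_loss -` {..optimal_value pop_loss W + e}"
    by (auto simp: sublevel_def)
  then show ?thesis
    using continuous_on_closed_vimage[OF closed_W, of pop_loss] continuous_pop_loss
    by (metis Int_commute closed_atMost)
qed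

lemma convex_sublevel: "convex (sublevel pop_loss W e)"
proof (rule convexI)
  fix y z and a b :: real
  let ?b = "optimal_value pop_loss W + e"
  assume yz: "y \<in> sublevel pop_loss W e" "z \<in> sublevel pop_loss W e"
    and ab: "0 \<le> a" "0 \<le> b" "a + b = 1"
  have a: "a = 1 - b"
    using ab by simp
  have "pop_loss (a *\<^sub>R y + b *\<^sub>R z) \<le> a * pop_loss y + b * pop_loss z"
    using convex_onD[OF convex_pop_loss, of b y z] yz ab by (simp add: a sublevel_def)
  also have "\<dots> \<le> a * ?b + b * ?b"
    using yz ab by (intro add_mono mult_left_mono) (auto simp: sublevel_def)
  also have "\<dots> = ?b"
    using ab by (simp flip: distrib_right)
  finally show "a *\<^sub>R y + b *\<^sub>R z \<in> sublevel pop_loss W e"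
    using convexD[OF convex_W _ _ ab, of y z] yz by (simp add: sublevel_def)
qed

lemma sublevel_nonempty: "e \<ge> 0 \<Longrightarrow> sublevel pop_loss W e \<noteq> {}"
  using minimizer_exists by (force simp: sublevel_def)

text \<open>The intermediate value theorem on the segment from a nearest minimiser \<open>v\<close> to \<open>w\<close>. The
  crossing point \<open>u\<close> still has \<open>v\<close> as a nearest minimiser, so that the error bound at \<open>u\<close>
  controls the length of the initial piece of this very segment.\<close>

lemma segment_crosses_level:
  assumes "w \<in> W" "w \<notin> sublevel pop_loss W e" "e \<ge> 0"
  obtains v s u where "v \<in> W" "pop_loss v = optimal_value pop_loss W"
    "0 \<le> s" "s \<le> 1" "u = v + s *\<^sub>R (w - v)" "u \<in> W"
    "pop_loss u = optimal_value pop_loss W + e"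
    "norm (u - v) \<le> norm (u - closest_point (optimal_set pop_loss W) u)"
proof -
  let ?S = "sublevel pop_loss W 0"
  define v where "v = closest_point ?S w"
  have S: "closed ?S" "?S \<noteq> {}"
    using closed_sublevel sublevel_nonempty[of 0] by auto
  have "v \<in> ?S"
    unfolding v_def using S by (rule closest_point_in_set)
  then have v: "v \<in> W" "pop_loss v = optimal_value pop_loss W"
    using optimal_value_le by (auto simp: sublevel_def intro: antisym)
  define h where "h s = v + s *\<^sub>R (w - v)" for s :: real
  have h_in: "h s \<in> W" if "s \<in> {0..1}" for s
    using convexD_alt[OF convex_W v(1) \<open>w \<in> W\<close>, of s] that
    by (simp add: h_def algebra_simps)
  have "continuous_on {0..1} (\<lambda>s. pop_loss (h s))"
    using h_in by (intro continuous_on_compose2[OF continuous_pop_loss])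
      (auto simp: h_def intro!: continuous_on_add continuous_on_const continuous_on_scaleR continuous_on_id)
  moreover have "pop_loss (h 0) \<le> optimal_value pop_loss W + e"
    "optimal_value pop_loss W + e \<le> pop_loss (h 1)"
    using v assms by (auto simp: h_def sublevel_def)
  ultimately obtain s where s: "0 \<le> s" "s \<le> 1"
    "pop_loss (h s) = optimal_value pop_loss W + e"
    using IVT'[of "\<lambda>s. pop_loss (h s)" 0 "optimal_value pop_loss W + e" 1] by auto
  have "norm (h s - v) \<le> norm (h s - closest_point ?S (h s))"
  proof (rule dist_segment_to_closest_point)
    show "norm (w - v) \<le> norm (w - y)" if "y \<in> ?S" for y
      using closest_point_le[OF S(1) that, of w] by (simp add: v_def dist_norm)
  qed (use s S closest_point_in_set in \<open>auto simp: h_def\<close>)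
  with v s h_in show thesis
    by (intro that[of v s "h s"]) (auto simp: h_def optimal_set_altdef)
qed

end

section \<open>The error bound beyond the sublevel set\<close>

locale error_bound_problem = bounded_subgradient_problem D W f g G
  for D :: "'s measure" and W :: "'a::euclidean_space set" and f g G +
  fixes e c \<theta> :: real
  assumes e_pos: "e > 0" and c_pos: "c > 0"
    and error_bound: "\<And>w. w \<in> sublevel pop_loss W e \<Longrightarrow>
          norm (w - closest_point (optimal_set pop_loss W) w)
            \<le> c * (pop_loss w - optimal_value pop_loss W) powr \<theta>"
begin

text \<open>By convexity the loss grows along the ray from \<open>v\<close> at least as fast beyond the crossing
  point \<open>u\<close> as it does on average between \<open>v\<close> and \<open>u\<close>, and there it gains \<open>e\<close> over a distance
  of at most \<open>c e\<^sup>\<theta>\<close>. So the local error bound turns into a global linear one.\<close>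

lemma dist_sublevel_le:
  assumes "w \<in> W" and gap: "pop_loss w - optimal_value pop_loss W \<le> e + d" and "d \<ge> 0"
  shows "norm (w - closest_point (sublevel pop_loss W e) w) \<le> c * e powr (\<theta> - 1) * d"
proof (cases "w \<in> sublevel pop_loss W e")
  case True
  then show ?thesis
    using c_pos \<open>d \<ge> 0\<close> by (simp add: closest_point_self)
next
  case False
  let ?opt = "optimal_value pop_loss W"
  obtain v s u where vsu: "v \<in> W" "pop_loss v = ?opt" "0 \<le> s" "s \<le> 1"
    "u = v + s *\<^sub>R (w - v)" "u \<in> W" "pop_loss u = ?opt + e"
    "norm (u - v) \<le> norm (u - closest_point (optimal_set pop_loss W) u)"
    using segment_crosses_level[OF \<open>w \<in> W\<close> False] e_pos by auto
  have u_in: "u \<in> sublevel pop_loss W e"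
    using vsu by (simp add: sublevel_def)
  have near: "norm (u - v) \<le> c * e powr \<theta>"
    using error_bound[OF u_in] vsu by simp
  have "u = (1 - s) *\<^sub>R v + s *\<^sub>R w"
    using vsu by (simp add: algebra_simps)
  then have "pop_loss u \<le> (1 - s) * pop_loss v + s * pop_loss w"
    using convex_onD[OF convex_pop_loss, of s v w] vsu(1,3,4) \<open>w \<in> W\<close> by simp
  then have "e \<le> s * (pop_loss w - ?opt)"
    unfolding vsu(2,7) by (simp add: algebra_simps)
  also have "\<dots> \<le> s * (e + d)"
    using gap vsu by (intro mult_left_mono) auto
  finally have growth: "(1 - s) * e \<le> s * d"
    by (simp add: algebra_simps)
  have "norm (u - v) = s * norm (w - v)"
    using vsu by simp
  have "w - u = (1 - s) *\<^sub>R (w - v)"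
    using vsu by (simp add: algebra_simps)
  then have "e * norm (w - u) = (1 - s) * e * norm (w - v)"
    using vsu by simp
  also have "\<dots> \<le> s * d * norm (w - v)"
    using growth by (intro mult_right_mono) auto
  also have "\<dots> = d * norm (u - v)"
    using \<open>norm (u - v) = s * norm (w - v)\<close> by simp
  also have "\<dots> \<le> d * (c * e powr \<theta>)"
    using near \<open>d \<ge> 0\<close> by (intro mult_left_mono) auto
  also have "\<dots> = e * (c * e powr (\<theta> - 1) * d)"
    using e_pos by (simp add: powr_diff)
  finally have "norm (w - u) \<le> c * e powr (\<theta> - 1) * d"
    using e_pos by simp
  then show ?thesis
    using closest_point_le[OF closed_sublevel u_in, of w] by (simp add: dist_norm)
qed

text \<open>Over a distance of at most \<open>c e\<^sup>\<theta>\<close> the loss falls by \<open>e\<close> from a crossing point to a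
  minimiser, whereas a Lipschitz function loses at most \<open>G c e\<^sup>\<theta>\<close> there. If everything is
  \<open>e\<close>-optimal, then there is no crossing point and no such bound.\<close>

lemma condition_number_ge_1:
  assumes "sublevel pop_loss W e \<noteq> W"
  shows "c\<^sup>2 * G\<^sup>2 / e powr (2 * (1 - \<theta>)) \<ge> 1"
proof -
  obtain w where w: "w \<in> W" "w \<notin> sublevel pop_loss W e"
    using assms by (auto simp: sublevel_def)
  let ?opt = "optimal_value pop_loss W"
  obtain v u where vu: "v \<in> W" "pop_loss v = ?opt" "u \<in> W" "pop_loss u = ?opt + e"
    "norm (u - v) \<le> norm (u - closest_point (optimal_set pop_loss W) u)"
    using segment_crosses_level[OF w less_imp_le[OF e_pos]] by metis
  have "e \<le> G * norm (u - v)"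
    using pop_loss_lipschitz[OF vu(3,1)] vu by simp
  also have "\<dots> \<le> G * (c * e powr \<theta>)"
    using error_bound[of u] vu G_nonneg by (intro mult_left_mono) (auto simp: sublevel_def)
  finally have "e powr (1 - \<theta>) \<le> c * G"
    using e_pos by (simp add: powr_diff field_simps)
  then have "(e powr (1 - \<theta>))\<^sup>2 \<le> (c * G)\<^sup>2"
    by (intro power_mono) auto
  moreover have "(e powr (1 - \<theta>))\<^sup>2 = e powr (2 * (1 - \<theta>))"
    by (simp flip: powr_powr add: powr_realpow mult.commute powr_powr powr_numeral[symmetric] del: powr_numeral)
  ultimately show ?thesis
    using e_pos by (simp add: field_simps)
qed

end

section \<open>One stage along a fixed sample path\<close>

lemma inner_iterate_Suc:
  "\<tau> \<ge> 1 \<Longrightarrow> inner_iterate W g \<beta> w1 x (Suc \<tau>) =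
     closest_point W ((1 - 2 / real \<tau>) *\<^sub>R inner_iterate W g \<beta> w1 x \<tau> + (2 / real \<tau>) *\<^sub>R w1
       - (2 * \<beta> / real \<tau>) *\<^sub>R g (inner_iterate W g \<beta> w1 x \<tau>) (x \<tau>))"
  by (simp add: Let_def)

declare inner_iterate.simps(2) [simp del]

lemma inner_iterate_1: "inner_iterate W g \<beta> w1 x (Suc 0) = w1"
  by (simp add: inner_iterate.simps)

lemma inner_iterate_in:
  assumes "closed W" "w1 \<in> W"
  shows "inner_iterate W g \<beta> w1 x \<tau> \<in> W"
proof (cases \<tau>)
  case (Suc n)
  then show ?thesis
    using assms closest_point_in_set[of W]
    by (cases "n = 0") (auto simp: inner_iterate_1 inner_iterate_Suc)
qed (use assms in simp)

lemma inner_iterate_cong: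
  assumes "\<And>j. j \<in> {1..<n} \<Longrightarrow> x j = y j"
  shows "inner_iterate W g \<beta> w1 x n = inner_iterate W g \<beta> w1 y n"
  using assms
proof (induction n)
  case (Suc n)
  then show ?case
    by (cases "n = 0") (simp_all add: inner_iterate_1 inner_iterate_Suc)
qed simp

text \<open>Non-expansiveness of the projection, with the square expanded.\<close>

lemma projected_step_le:
  fixes W :: "'a::euclidean_space set"
  assumes "closed W" "convex W" "u \<in> W"
  shows "(norm (closest_point W (w - \<eta> *\<^sub>R d) - u))\<^sup>2
           \<le> (norm (w - u))\<^sup>2 - 2 * \<eta> * (d \<bullet> (w - u)) + \<eta>\<^sup>2 * (norm d)\<^sup>2"
proof -
  have "norm (closest_point W (w - \<eta> *\<^sub>R d) - u) \<le> norm ((w - \<eta> *\<^sub>R d) - u)"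
    using closest_point_lipschitz[OF \<open>convex W\<close> \<open>closed W\<close>, of "w - \<eta> *\<^sub>R d" u] \<open>u \<in> W\<close>
    by (auto simp: closest_point_self dist_norm)
  then have "(norm (closest_point W (w - \<eta> *\<^sub>R d) - u))\<^sup>2 \<le> (norm ((w - u) - \<eta> *\<^sub>R d))\<^sup>2"
    by (intro power_mono) (simp_all add: algebra_simps)
  also have "\<dots> = (norm (w - u))\<^sup>2 - 2 * \<eta> * (d \<bullet> (w - u)) + \<eta>\<^sup>2 * (norm d)\<^sup>2"
    unfolding power2_norm_eq_inner
    by (simp add: inner_diff_left inner_diff_right inner_commute power2_eq_square algebra_simps)
  finally show ?thesis .
qed

context bounded_subgradient_problem
begin

text \<open>Each update draws the current point towards \<open>w1\<close> and adds a step that shrinks at the same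
  rate as the weight of \<open>w1\<close>, so a stage never leaves a ball around \<open>w1\<close>. After two updates
  radius \<open>\<beta> G\<close> would do; the factor 2 is due to the first update, a step of length up to
  \<open>2 \<beta> G\<close> from \<open>w1\<close>.\<close>

lemma norm_inner_iterate_le:
  assumes "w1 \<in> W" "\<beta> \<ge> 0" and x: "\<And>j. j \<in> {1..<n} \<Longrightarrow> x j \<in> space D"
  shows "norm (inner_iterate W g \<beta> w1 x n - w1) \<le> 2 * \<beta> * G"
  using x
proof (induction n)
  case 0
  then show ?case using \<open>\<beta> \<ge> 0\<close> G_nonneg by simp
next
  case (Suc n)
  show ?case
  proof (cases "n = 0")
    case True
    then show ?thesis using \<open>\<beta> \<ge> 0\<close> G_nonneg by (simp add: inner_iterate_1)
  next
    case False
    then have "n \<ge> 1" by simp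
    define w where "w = inner_iterate W g \<beta> w1 x n"
    let ?d = "(1 - 2 / real n) *\<^sub>R (w - w1) - (2 * \<beta> / real n) *\<^sub>R g w (x n)"
    have "w \<in> W"
      unfolding w_def using inner_iterate_in closed_W \<open>w1 \<in> W\<close> by blast
    have IH: "norm (w - w1) \<le> 2 * \<beta> * G"
      unfolding w_def using Suc by simp
    have noise: "norm ((2 * \<beta> / real n) *\<^sub>R g w (x n)) \<le> (2 / real n) * (\<beta> * G)"
      using mult_left_mono[OF norm_g_le[OF \<open>w \<in> W\<close>, of "x n"], of "2 * \<beta> / real n"]
        Suc.prems[of n] \<open>n \<ge> 1\<close> \<open>\<beta> \<ge> 0\<close> by simp
    have "norm (inner_iterate W g \<beta> w1 x (Suc n) - w1) \<le> norm ?d"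
      using closest_point_lipschitz[OF convex_W closed_W W_nonempty, of "?d + w1" w1]
        closest_point_self[OF \<open>w1 \<in> W\<close>] inner_iterate_Suc[OF \<open>n \<ge> 1\<close>, of W g \<beta> w1 x]
      by (simp add: dist_norm w_def algebra_simps)
    also have "\<dots> \<le> \<bar>1 - 2 / real n\<bar> * norm (w - w1) + (2 / real n) * (\<beta> * G)"
      using noise by (intro order.trans[OF norm_triangle_ineq4] add_mono) simp_all
    also have "\<dots> \<le> 2 * \<beta> * G"
    proof (cases "n = 1")
      case True
      \<comment> \<open>The weight \<open>1 - 2 / n\<close> is \<open>-1\<close> here, but it multiplies \<open>w1 - w1\<close>.\<close>
      then show ?thesis by (simp add: w_def inner_iterate_1)
    next
      case False
      then have "2 / real n \<le> 1"
        using \<open>n \<ge> 1\<close> by simp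
      then have "\<bar>1 - 2 / real n\<bar> * norm (w - w1) \<le> (1 - 2 / real n) * (2 * \<beta> * G)"
        using IH by (simp add: mult_left_mono)
      moreover have "0 \<le> 2 / real n * (\<beta> * G)"
        using \<open>\<beta> \<ge> 0\<close> G_nonneg by simp
      moreover have "(1 - 2 / real n) * (2 * \<beta> * G) = 2 * \<beta> * G - 2 * (2 / real n * (\<beta> * G))"
        by (simp add: algebra_simps)
      ultimately show ?thesis
        by linarith
    qed
    finally show ?thesis .
  qed
qed

definition noise_term :: "'a \<Rightarrow> 'a \<Rightarrow> 's \<Rightarrow> real" where
  "noise_term u w x = (mean_subgradient w - g w x) \<bullet> (w - u)"

text \<open>The squared distances are the share of strong convexity that is set aside to pay for the
  variance of the noise, which is proportional to them.\<close>

definition compensated_noise :: "real \<Rightarrow> 'a \<Rightarrow> 'a \<Rightarrow> (nat \<Rightarrow> 's) \<Rightarrow> nat \<Rightarrow> real" where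
  "compensated_noise \<beta> w1 u x n = (\<Sum>\<tau>=1..<n. let w = inner_iterate W g \<beta> w1 x \<tau> in
      noise_term u w (x \<tau>) - (norm (w - u))\<^sup>2 / (4 * \<beta>))"

text \<open>The regularised loss \<open>F w + |w - w1|\<^sup>2 / (2 \<beta>)\<close> is strongly convex with modulus \<open>1 / \<beta>\<close>, and
  an update is a subgradient step on it. The direction \<open>h\<close> is left open, since it is a sampled
  subgradient at all iterates but the last one.\<close>

lemma regularised_gap_le:
  assumes "w \<in> W" "u \<in> W" "\<beta> > 0"
  shows "pop_loss w - pop_loss u - (norm (u - w1))\<^sup>2 / (2 * \<beta>)
    \<le> (mean_subgradient w - h) \<bullet> (w - u) + (h + (1 / \<beta>) *\<^sub>R (w - w1)) \<bullet> (w - u)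
      - (norm (w - u))\<^sup>2 / (2 * \<beta>)"
proof -
  have sub: "pop_loss w - pop_loss u \<le> mean_subgradient w \<bullet> (w - u)"
    using mean_subgradient_is_subgradient[OF \<open>w \<in> W\<close> \<open>u \<in> W\<close> norm_g_le] \<open>w \<in> W\<close>
    by (simp add: inner_diff_right)
  have "2 * ((w - w1) \<bullet> (w - u)) = (norm (w - w1))\<^sup>2 + (norm (w - u))\<^sup>2 - (norm (u - w1))\<^sup>2"
    unfolding power2_norm_eq_inner
    by (simp add: inner_diff_left inner_diff_right inner_commute algebra_simps)
  then have "2 * ((w - w1) \<bullet> (w - u)) \<ge> (norm (w - u))\<^sup>2 - (norm (u - w1))\<^sup>2"
    by simp
  then have "(w - w1) \<bullet> (w - u) / \<beta> \<ge> ((norm (w - u))\<^sup>2 - (norm (u - w1))\<^sup>2) / (2 * \<beta>)"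
    using divide_right_mono[of _ "2 * ((w - w1) \<bullet> (w - u))" "2 * \<beta>"] \<open>\<beta> > 0\<close> by simp
  with sub show ?thesis
    by (simp add: inner_add_left inner_diff_left diff_divide_distrib)
qed

lemma norm_regularised_direction_le:
  assumes "norm h \<le> G" "norm (w - w1) \<le> 2 * \<beta> * G" "\<beta> > 0"
  shows "(norm (h + (1 / \<beta>) *\<^sub>R (w - w1)))\<^sup>2 \<le> 9 * G\<^sup>2"
proof -
  have "norm (h + (1 / \<beta>) *\<^sub>R (w - w1)) \<le> norm h + norm ((1 / \<beta>) *\<^sub>R (w - w1))"
    by (rule norm_triangle_ineq)
  also have "\<dots> \<le> G + 2 * G"
    using assms by (intro add_mono) (simp_all add: divide_simps ac_simps)
  finally have "(norm (h + (1 / \<beta>) *\<^sub>R (w - w1)))\<^sup>2 \<le> (3 * G)\<^sup>2"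
    by (intro power_mono) auto
  then show ?thesis by (simp add: power_mult_distrib)
qed

text \<open>With step size \<open>2 \<beta> / \<tau>\<close> the squared distances almost telescope: summation by parts leaves
  half of the strong convexity terms over, and \<open>compensated_noise\<close> absorbs them.\<close>

lemma sum_gaps_le:
  assumes "w1 \<in> W" "u \<in> W" "\<beta> > 0" and x: "\<And>j. j \<in> {1..n} \<Longrightarrow> x j \<in> space D"
  defines "w \<equiv> inner_iterate W g \<beta> w1 x"
  shows "(\<Sum>\<tau>=1..n. pop_loss (w \<tau>) - pop_loss u - (norm (u - w1))\<^sup>2 / (2 * \<beta>))
    \<le> compensated_noise \<beta> w1 u x (Suc n) + 9 * \<beta> * G\<^sup>2 * harm n
      - real n / (4 * \<beta>) * (norm (w (Suc n) - u))\<^sup>2"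
  using x
proof (induction n)
  case 0
  then show ?case by (simp add: compensated_noise_def harm_def)
next
  case (Suc n)
  let ?m = "real (Suc n)" and ?v = "w (Suc n)" and ?x = "x (Suc n)"
  define d where "d = g ?v ?x + (1 / \<beta>) *\<^sub>R (?v - w1)"
  have v_in: "?v \<in> W"
    unfolding w_def using inner_iterate_in closed_W \<open>w1 \<in> W\<close> by blast
  have "norm (?v - w1) \<le> 2 * \<beta> * G"
    unfolding w_def by (rule norm_inner_iterate_le) (use assms Suc.prems in auto)
  then have d_le: "(norm d)\<^sup>2 \<le> 9 * G\<^sup>2"
    unfolding d_def using norm_g_le[OF v_in] Suc.prems[of "Suc n"] \<open>\<beta> > 0\<close>
    by (intro norm_regularised_direction_le) auto
  have "w (Suc (Suc n)) = closest_point W (?v - (2 * \<beta> / ?m) *\<^sub>R d)"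
    unfolding w_def d_def using \<open>\<beta> > 0\<close>
    by (subst inner_iterate_Suc) (simp_all add: algebra_simps)
  then have "(norm (w (Suc (Suc n)) - u))\<^sup>2
      \<le> (norm (?v - u))\<^sup>2 - 2 * (2 * \<beta> / ?m) * (d \<bullet> (?v - u)) + (2 * \<beta> / ?m)\<^sup>2 * (norm d)\<^sup>2"
    using projected_step_le[OF closed_W convex_W \<open>u \<in> W\<close>] by (simp only:)
  also have "\<dots> \<le> (norm (?v - u))\<^sup>2 - 2 * (2 * \<beta> / ?m) * (d \<bullet> (?v - u))
      + (2 * \<beta> / ?m)\<^sup>2 * (9 * G\<^sup>2)"
    using d_le by (intro add_left_mono mult_left_mono) auto
  finally have "4 * \<beta> / ?m * (d \<bullet> (?v - u))
      \<le> (norm (?v - u))\<^sup>2 - (norm (w (Suc (Suc n)) - u))\<^sup>2 + 4 * \<beta>\<^sup>2 / ?m\<^sup>2 * (9 * G\<^sup>2)"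
    by (simp add: power_divide power_mult_distrib)
  then have "?m / (4 * \<beta>) * (4 * \<beta> / ?m * (d \<bullet> (?v - u))) \<le> ?m / (4 * \<beta>) *
      ((norm (?v - u))\<^sup>2 - (norm (w (Suc (Suc n)) - u))\<^sup>2 + 4 * \<beta>\<^sup>2 / ?m\<^sup>2 * (9 * G\<^sup>2))"
    using \<open>\<beta> > 0\<close> by (intro mult_left_mono) auto
  moreover have "?m / (4 * \<beta>) * (4 * \<beta> / ?m * (d \<bullet> (?v - u))) = d \<bullet> (?v - u)"
    using \<open>\<beta> > 0\<close> by simp
  moreover have "m / (4 * \<beta>) * (a - b + 4 * \<beta>\<^sup>2 / m\<^sup>2 * (9 * G\<^sup>2))
      = m / (4 * \<beta>) * a - m / (4 * \<beta>) * b + 9 * \<beta> * G\<^sup>2 * inverse m" if "m > 0" for a b m :: real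
    using \<open>\<beta> > 0\<close> that by (simp add: distrib_left right_diff_distrib power2_eq_square inverse_eq_divide)
  note this[of ?m "(norm (?v - u))\<^sup>2" "(norm (w (Suc (Suc n)) - u))\<^sup>2"]
  ultimately have step: "d \<bullet> (?v - u) \<le> ?m / (4 * \<beta>) * (norm (?v - u))\<^sup>2
      - ?m / (4 * \<beta>) * (norm (w (Suc (Suc n)) - u))\<^sup>2 + 9 * \<beta> * G\<^sup>2 * inverse ?m"
    by simp
  have gap: "pop_loss ?v - pop_loss u - (norm (u - w1))\<^sup>2 / (2 * \<beta>)
      \<le> noise_term u ?v ?x + d \<bullet> (?v - u) - (norm (?v - u))\<^sup>2 / (2 * \<beta>)"
    unfolding d_def noise_term_def by (rule regularised_gap_le[OF v_in \<open>u \<in> W\<close> \<open>\<beta> > 0\<close>])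
  have "?m / (4 * \<beta>) * (norm (?v - u))\<^sup>2 - (norm (?v - u))\<^sup>2 / (2 * \<beta>)
      = real n / (4 * \<beta>) * (norm (?v - u))\<^sup>2 - (norm (?v - u))\<^sup>2 / (4 * \<beta>)"
    using \<open>\<beta> > 0\<close> by (simp add: field_simps)
  moreover have "compensated_noise \<beta> w1 u x (Suc (Suc n)) = compensated_noise \<beta> w1 u x (Suc n)
      + (noise_term u ?v ?x - (norm (?v - u))\<^sup>2 / (4 * \<beta>))"
    by (simp add: compensated_noise_def w_def Let_def)
  moreover have "9 * \<beta> * G\<^sup>2 * harm (Suc n) = 9 * \<beta> * G\<^sup>2 * harm n + 9 * \<beta> * G\<^sup>2 * inverse ?m"
    by (simp add: harm_Suc distrib_left)
  ultimately show ?case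
    using Suc.IH Suc.prems step gap by (simp add: sum.cl_ivl_Suc)
qed

text \<open>The last iterate enters the average but no sample is drawn at it. The mean subgradient takes
  the role of the sample there, and Young's inequality that of the missing projection step.\<close>

lemma stage_average_le:
  assumes "w1 \<in> W" "u \<in> W" "\<beta> > 0" "t \<ge> 1" and x: "\<And>j. j \<in> {1..<t} \<Longrightarrow> x j \<in> space D"
  shows "real t * (pop_loss ((1 / real t) *\<^sub>R (\<Sum>\<tau>=1..t. inner_iterate W g \<beta> w1 x \<tau>)) - pop_loss u)
    \<le> real t * ((norm (u - w1))\<^sup>2 / (2 * \<beta>)) + 9 * \<beta> * G\<^sup>2 * (1 + ln (real t))
      + compensated_noise \<beta> w1 u x t"
proof -
  define w where "w = inner_iterate W g \<beta> w1 x"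
  obtain n where t: "t = Suc n"
    using \<open>t \<ge> 1\<close> by (cases t) auto
  let ?v = "w t" and ?R = "(norm (u - w1))\<^sup>2 / (2 * \<beta>)"
  define d where "d = mean_subgradient ?v + (1 / \<beta>) *\<^sub>R (?v - w1)"
  have w_in: "w \<tau> \<in> W" for \<tau>
    unfolding w_def using inner_iterate_in closed_W \<open>w1 \<in> W\<close> by blast
  have "norm (?v - w1) \<le> 2 * \<beta> * G"
    unfolding w_def using assms by (intro norm_inner_iterate_le) auto
  then have d_le: "(norm d)\<^sup>2 \<le> 9 * G\<^sup>2"
    unfolding d_def using norm_mean_subgradient_le norm_g_le w_in \<open>\<beta> > 0\<close>
    by (intro norm_regularised_direction_le) auto
  have young: "d \<bullet> (?v - u) \<le> \<beta> / real t * (norm d)\<^sup>2 + real t / (4 * \<beta>) * (norm (?v - u))\<^sup>2"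
  proof -
    have "0 \<le> (norm ((2 * \<beta>) *\<^sub>R d - real t *\<^sub>R (?v - u)))\<^sup>2"
      by simp
    also have "\<dots> = 4 * \<beta>\<^sup>2 * (norm d)\<^sup>2 - 4 * \<beta> * real t * (d \<bullet> (?v - u))
        + (real t)\<^sup>2 * (norm (?v - u))\<^sup>2"
      unfolding power2_norm_eq_inner
      by (simp add: inner_diff_left inner_diff_right inner_commute power2_eq_square algebra_simps)
    finally have "4 * \<beta> * real t * (d \<bullet> (?v - u))
        \<le> 4 * \<beta>\<^sup>2 * (norm d)\<^sup>2 + (real t)\<^sup>2 * (norm (?v - u))\<^sup>2"
      by simp
    also have "\<dots> = 4 * \<beta> * real t *
        (\<beta> / real t * (norm d)\<^sup>2 + real t / (4 * \<beta>) * (norm (?v - u))\<^sup>2)"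
      using \<open>\<beta> > 0\<close> \<open>t \<ge> 1\<close> by (simp add: field_simps power2_eq_square)
    finally show ?thesis
      using \<open>\<beta> > 0\<close> \<open>t \<ge> 1\<close> by simp
  qed
  have "\<beta> / real t * (norm d)\<^sup>2 \<le> \<beta> / real t * (9 * G\<^sup>2)"
    using d_le \<open>\<beta> > 0\<close> by (intro mult_left_mono) auto
  then have d_le': "\<beta> / real t * (norm d)\<^sup>2 \<le> 9 * \<beta> * G\<^sup>2 * inverse (real t)"
    by (simp add: field_simps)
  have "pop_loss ?v - pop_loss u - ?R
      \<le> (mean_subgradient ?v - mean_subgradient ?v) \<bullet> (?v - u) + d \<bullet> (?v - u)
        - (norm (?v - u))\<^sup>2 / (2 * \<beta>)"
    unfolding d_def by (rule regularised_gap_le[OF w_in \<open>u \<in> W\<close> \<open>\<beta> > 0\<close>])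
  then have last: "pop_loss ?v - pop_loss u - ?R \<le> 9 * \<beta> * G\<^sup>2 * inverse (real t)
      + real t / (4 * \<beta>) * (norm (?v - u))\<^sup>2 - (norm (?v - u))\<^sup>2 / (2 * \<beta>)"
    using young d_le' by simp
  have sum_n: "(\<Sum>\<tau>=1..n. pop_loss (w \<tau>) - pop_loss u - ?R)
      \<le> compensated_noise \<beta> w1 u x t + 9 * \<beta> * G\<^sup>2 * harm n - real n / (4 * \<beta>) * (norm (?v - u))\<^sup>2"
    using sum_gaps_le[OF assms(1,2,3), of n x] x unfolding w_def t by simp
  \<comment> \<open>The three coefficients of the last squared distance add up to \<open>- 1 / (4 \<beta>)\<close>.\<close>
  have coeff: "real t / (4 * \<beta>) * (norm (?v - u))\<^sup>2 - (norm (?v - u))\<^sup>2 / (2 * \<beta>)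
      - real n / (4 * \<beta>) * (norm (?v - u))\<^sup>2 \<le> 0"
    using \<open>\<beta> > 0\<close> by (simp add: t field_simps)
  have "(\<Sum>\<tau>=1..t. pop_loss (w \<tau>) - pop_loss u - ?R)
      = (\<Sum>\<tau>=1..n. pop_loss (w \<tau>) - pop_loss u - ?R) + (pop_loss ?v - pop_loss u - ?R)"
    by (simp add: t)
  also have "\<dots> \<le> compensated_noise \<beta> w1 u x t + 9 * \<beta> * G\<^sup>2 * (harm n + inverse (real t))"
    using last sum_n coeff by (simp add: distrib_left)
  also have "harm n + inverse (real t) = harm t"
    by (simp add: t harm_Suc)
  also have "9 * \<beta> * G\<^sup>2 * harm t \<le> 9 * \<beta> * G\<^sup>2 * (1 + ln (real t))"
    using decseqD[OF decseq_harm_diff_ln, of 0 n] \<open>\<beta> > 0\<close>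
    by (intro mult_left_mono) (simp_all add: t harm_expand)
  finally have total: "(\<Sum>\<tau>=1..t. pop_loss (w \<tau>)) - real t * pop_loss u - real t * ?R
      \<le> compensated_noise \<beta> w1 u x t + 9 * \<beta> * G\<^sup>2 * (1 + ln (real t))"
    by (simp add: sum_subtractf)
  have "pop_loss (\<Sum>\<tau>\<in>{1..t}. (1 / real t) *\<^sub>R w \<tau>) \<le> (\<Sum>\<tau>\<in>{1..t}. 1 / real t * pop_loss (w \<tau>))"
    using convex_on_sum[OF _ _ convex_pop_loss, of "{1..t}" "\<lambda>_. 1 / real t" w] w_in \<open>t \<ge> 1\<close>
    by simp
  then have "real t * pop_loss ((1 / real t) *\<^sub>R (\<Sum>\<tau>=1..t. w \<tau>)) \<le> (\<Sum>\<tau>=1..t. pop_loss (w \<tau>))"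
    using \<open>t \<ge> 1\<close> by (simp add: field_simps flip: scaleR_sum_right sum_divide_distrib)
  with total show ?thesis
    unfolding w_def by (simp add: right_diff_distrib)
qed

end

section \<open>Exponential moments of the noise\<close>

text \<open>The past and a fresh sample have a product distribution, so Tonelli's theorem allows one to
  integrate the fresh sample out first, with the past held constant.\<close>

lemma (in prob_space) nn_integral_fresh_sample_le:
  assumes indep: "indep_vars (\<lambda>_. D) Y I"
    and "J \<subseteq> I" "i \<in> I" "i \<notin> J" and distr: "distr M D (Y i) = D"
    and a: "a \<in> borel_measurable (PiM J (\<lambda>_. D))"
    and b: "case_prod b \<in> borel_measurable (PiM J (\<lambda>_. D) \<Otimes>\<^sub>M D)"
    and b_le: "\<And>p. p \<in> space (PiM J (\<lambda>_. D)) \<Longrightarrow> (\<integral>\<^sup>+x. b p x \<partial>D) \<le> 1"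
  defines "past \<equiv> \<lambda>\<omega>. restrict (\<lambda>j. Y j \<omega>) J"
  shows "(\<integral>\<^sup>+\<omega>. a (past \<omega>) * b (past \<omega>) (Y i \<omega>) \<partial>M) \<le> (\<integral>\<^sup>+\<omega>. a (past \<omega>) \<partial>M)"
proof -
  let ?N = "PiM J (\<lambda>_. D)" and ?S = "PiM {i} (\<lambda>_. D)"
  define fresh where "fresh \<omega> = restrict (\<lambda>j. Y j \<omega>) {i}" for \<omega>
  have iv: "indep_var ?N past ?S fresh"
    unfolding past_def fresh_def using assms by (intro indep_var_restrict[OF indep]) auto
  then have past: "past \<in> measurable M ?N" and fresh: "fresh \<in> measurable M ?S"
    by (auto dest: indep_var_rv1 indep_var_rv2)
  have Yi: "Y i \<in> measurable M D"
    using indep \<open>i \<in> I\<close> by (simp add: indep_vars_def2)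
  interpret S: prob_space "distr M ?S fresh"
    using fresh by (rule prob_space_distr)
  have joint: "distr M (?N \<Otimes>\<^sub>M ?S) (\<lambda>\<omega>. (past \<omega>, fresh \<omega>)) = distr M ?N past \<Otimes>\<^sub>M distr M ?S fresh"
    using iv by (simp add: indep_var_distribution_eq)
  have eval: "(\<lambda>q. q i) \<in> measurable ?S D"
    by (intro measurable_component_singleton) simp
  have b': "(\<lambda>(p, q). b p (q i)) \<in> borel_measurable (?N \<Otimes>\<^sub>M ?S)"
    using measurable_compose[OF measurable_Pair[OF measurable_fst measurable_compose[OF measurable_snd eval]] b]
    by (simp add: case_prod_beta')
  have ab: "(\<lambda>(p, q). a p * b p (q i)) \<in> borel_measurable (?N \<Otimes>\<^sub>M ?S)"
    using borel_measurable_times_ennreal[OF measurable_compose[OF measurable_fst a] b'[unfolded case_prod_beta']]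
    by (simp add: case_prod_beta')
  have b_slice: "b p \<in> borel_measurable D" if "p \<in> space ?N" for p
    using measurable_compose[OF measurable_Pair1'[OF that] b] by simp
  have "(\<integral>\<^sup>+\<omega>. a (past \<omega>) * b (past \<omega>) (Y i \<omega>) \<partial>M)
      = (\<integral>\<^sup>+z. (\<lambda>(p, q). a p * b p (q i)) z \<partial>distr M (?N \<Otimes>\<^sub>M ?S) (\<lambda>\<omega>. (past \<omega>, fresh \<omega>)))"
    using nn_integral_distr[OF measurable_Pair[OF past fresh], of "\<lambda>(p, q). a p * b p (q i)"] ab
    by (simp add: fresh_def)
  also have "\<dots> = (\<integral>\<^sup>+p. \<integral>\<^sup>+q. a p * b p (q i) \<partial>distr M ?S fresh \<partial>distr M ?N past)"
    unfolding joint using ab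
    by (subst S.nn_integral_fst[symmetric]) (simp_all cong: measurable_cong_sets sets_pair_measure_cong)
  also have "\<dots> \<le> (\<integral>\<^sup>+p. a p \<partial>distr M ?N past)"
  proof (rule nn_integral_mono)
    fix p assume "p \<in> space (distr M ?N past)"
    then have p: "p \<in> space ?N" by simp
    note b_eval = measurable_compose[OF eval b_slice[OF p]]
    have "(\<integral>\<^sup>+q. a p * b p (q i) \<partial>distr M ?S fresh) = a p * (\<integral>\<^sup>+q. b p (q i) \<partial>distr M ?S fresh)"
      using b_eval by (intro nn_integral_cmult) simp
    also have "(\<integral>\<^sup>+q. b p (q i) \<partial>distr M ?S fresh) = (\<integral>\<^sup>+\<omega>. b p (Y i \<omega>) \<partial>M)"
      using nn_integral_distr[OF fresh, of "\<lambda>q. b p (q i)"] b_eval by (simp add: fresh_def)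
    also have "\<dots> = (\<integral>\<^sup>+x. b p x \<partial>distr M D (Y i))"
      using nn_integral_distr[OF Yi, of "b p"] b_slice[OF p] by simp
    also have "a p * \<dots> \<le> a p"
      unfolding distr using mult_left_mono[OF b_le[OF p], of "a p"] by simp
    finally show "(\<integral>\<^sup>+q. a p * b p (q i) \<partial>distr M ?S fresh) \<le> a p" .
  qed
  also have "\<dots> = (\<integral>\<^sup>+\<omega>. a (past \<omega>) \<partial>M)"
    using nn_integral_distr[OF past, of a] a by simp
  finally show ?thesis .
qed

context bounded_subgradient_problem
begin

lemma measurable_closest_point_W: "closest_point W \<in> borel_measurable borel"
  by (intro borel_measurable_continuous_onI continuous_on_closest_point
      convex_W closed_W W_nonempty)

lemma measurable_inner_iterate:
  assumes v: "v \<in> borel_measurable N" and X: "\<And>j. j \<in> {1..<n} \<Longrightarrow> X j \<in> measurable N D"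
  shows "(\<lambda>p. inner_iterate W g \<beta> (v p) (\<lambda>j. X j p) n) \<in> borel_measurable N"
  using X
proof (induction n)
  case (Suc n)
  show ?case
  proof (cases "n = 0")
    case False
    then have [measurable]: "(\<lambda>p. inner_iterate W g \<beta> (v p) (\<lambda>j. X j p) n) \<in> borel_measurable N"
        "X n \<in> measurable N D"
      using Suc by auto
    note [measurable] = v measurable_g_compose
    show ?thesis
      using False by (simp add: inner_iterate_Suc)
        (intro measurable_compose[OF _ measurable_closest_point_W], measurable)
  qed (use v in \<open>simp add: inner_iterate_1\<close>)
qed (use v in simp)

lemma measurable_compensated_noise:
  assumes v: "v \<in> borel_measurable N" and u: "u \<in> borel_measurable N"
    and X: "\<And>j. j \<in> {1..<n} \<Longrightarrow> X j \<in> measurable N D"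
  shows "(\<lambda>p. compensated_noise \<beta> (v p) (u p) (\<lambda>j. X j p) n) \<in> borel_measurable N"
  unfolding compensated_noise_def Let_def noise_term_def
proof (rule borel_measurable_sum)
  fix \<tau> assume \<tau>: "\<tau> \<in> {1..<n}"
  have [measurable]: "(\<lambda>p. inner_iterate W g \<beta> (v p) (\<lambda>j. X j p) \<tau>) \<in> borel_measurable N"
    using \<tau> by (intro measurable_inner_iterate v X) auto
  note [measurable] = u X[OF \<tau>] measurable_g_compose
    measurable_compose[OF _ measurable_mean_subgradient]
  show "(\<lambda>p. (mean_subgradient (inner_iterate W g \<beta> (v p) (\<lambda>j. X j p) \<tau>)
        - g (inner_iterate W g \<beta> (v p) (\<lambda>j. X j p) \<tau>) (X \<tau> p))
          \<bullet> (inner_iterate W g \<beta> (v p) (\<lambda>j. X j p) \<tau> - u p)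
        - (norm (inner_iterate W g \<beta> (v p) (\<lambda>j. X j p) \<tau> - u p))\<^sup>2 / (4 * \<beta>)) \<in> borel_measurable N"
    by measurable
qed

lemma compensated_noise_cong:
  assumes "\<And>j. j \<in> {1..<n} \<Longrightarrow> x j = y j"
  shows "compensated_noise \<beta> w1 u x n = compensated_noise \<beta> w1 u y n"
  unfolding compensated_noise_def
proof (rule sum.cong)
  fix \<tau> assume "\<tau> \<in> {1..<n}"
  with assms have "x \<tau> = y \<tau>" "inner_iterate W g \<beta> w1 x \<tau> = inner_iterate W g \<beta> w1 y \<tau>"
    by (auto intro!: inner_iterate_cong)
  then show "(let w = inner_iterate W g \<beta> w1 x \<tau> in
        noise_term u w (x \<tau>) - (norm (w - u))\<^sup>2 / (4 * \<beta>))
      = (let w = inner_iterate W g \<beta> w1 y \<tau> in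
        noise_term u w (y \<tau>) - (norm (w - u))\<^sup>2 / (4 * \<beta>))"
    by simp
qed simp

text \<open>The noise at \<open>w\<close> has mean zero and ranges over an interval of length \<open>2 G |w - u|\<close>, so
  Hoeffding's lemma bounds its exponential moment by \<open>exp (s\<^sup>2 G\<^sup>2 |w - u|\<^sup>2 / 2)\<close>. The compensator
  cancels that when \<open>s\<close> is small enough: both are multiples of \<open>|w - u|\<^sup>2\<close>, so the estimate does
  not depend on how far \<open>w\<close> is from \<open>u\<close>.\<close>

lemma nn_integral_exp_noise_le_1:
  assumes "w \<in> W" "s > 0" "\<beta> > 0" and s: "2 * s * \<beta> * G\<^sup>2 \<le> 1"
  shows "(\<integral>\<^sup>+x. ennreal (exp (s * (noise_term u w x - (norm (w - u))\<^sup>2 / (4 * \<beta>)))) \<partial>D) \<le> 1"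
proof -
  let ?m = "mean_subgradient w \<bullet> (w - u)" and ?r = "norm (w - u)"
  have int: "integrable D (g w)"
    using norm_g_le[OF \<open>w \<in> W\<close>] by (rule integrable_g)
  have meas: "noise_term u w \<in> borel_measurable D"
    unfolding noise_term_def using measurable_g_slice[of w] by measurable
  have bound: "\<bar>g w x \<bullet> (w - u)\<bar> \<le> G * ?r" if "x \<in> space D" for x
    using norm_g_le[OF \<open>w \<in> W\<close> that]
    by (intro order.trans[OF Cauchy_Schwarz_ineq2] mult_right_mono) auto
  interpret noise: interval_bounded_random_variable D "noise_term u w" "?m - G * ?r" "?m + G * ?r"
  proof unfold_locales
    show "AE x in D. noise_term u w x \<in> {?m - G * ?r..?m + G * ?r}"
      using bound by (intro AE_I2) (auto simp: noise_term_def inner_diff_left abs_le_iff)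
  qed (rule meas)
  have "expectation (noise_term u w) = 0"
    unfolding noise_term_def using int
    by (simp add: mean_subgradient_def prob_space)
  from noise.Hoeffdings_lemma_nn_integral_0[OF \<open>s > 0\<close> this]
  have hoeffding: "(\<integral>\<^sup>+x. ennreal (exp (s * noise_term u w x)) \<partial>D)
      \<le> ennreal (exp (s\<^sup>2 * (2 * G * ?r)\<^sup>2 / 8))"
    by (simp add: power_mult_distrib)
  let ?k = "exp (- (s * ?r\<^sup>2 / (4 * \<beta>)))"
  have "(\<integral>\<^sup>+x. ennreal (exp (s * (noise_term u w x - ?r\<^sup>2 / (4 * \<beta>)))) \<partial>D)
      = (\<integral>\<^sup>+x. ennreal ?k * ennreal (exp (s * noise_term u w x)) \<partial>D)"
    by (simp add: right_diff_distrib exp_diff exp_minus field_simps flip: ennreal_mult)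
  also have "\<dots> = ennreal ?k * (\<integral>\<^sup>+x. ennreal (exp (s * noise_term u w x)) \<partial>D)"
    using meas by (intro nn_integral_cmult) measurable
  also have "\<dots> \<le> ennreal ?k * ennreal (exp (s\<^sup>2 * (2 * G * ?r)\<^sup>2 / 8))"
    using hoeffding by (rule mult_left_mono) simp
  also have "\<dots> = ennreal (exp (s\<^sup>2 * (2 * G * ?r)\<^sup>2 / 8 - s * ?r\<^sup>2 / (4 * \<beta>)))"
    by (simp add: exp_add[symmetric] flip: ennreal_mult)
  also have "s\<^sup>2 * (2 * G * ?r)\<^sup>2 / 8 - s * ?r\<^sup>2 / (4 * \<beta>)
      = (2 * s * \<beta> * G\<^sup>2 - 1) * (s * ?r\<^sup>2 / (4 * \<beta>))"
    using \<open>\<beta> > 0\<close> by (simp add: field_simps power2_eq_square)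
  also have "ennreal (exp \<dots>) \<le> ennreal 1"
    using s \<open>s > 0\<close> \<open>\<beta> > 0\<close> by (intro ennreal_leI) (simp add: mult_nonpos_nonneg divide_nonpos_pos)
  finally show ?thesis by simp
qed

text \<open>The exponential of the compensated noise is a supermartingale along a stage: its last factor
  has conditional mean at most 1. Starting point and comparator may depend on the samples indexed
  by \<open>H\<close>, the history before the stage.\<close>

lemma nn_integral_exp_compensated_noise_le_1:
  fixes Y :: "'i \<Rightarrow> 'm \<Rightarrow> 's" and \<iota> :: "nat \<Rightarrow> 'i"
  assumes "prob_space M" and indep: "prob_space.indep_vars M (\<lambda>_. D) Y I"
    and distr: "\<And>i. i \<in> I \<Longrightarrow> distr M D (Y i) = D"
    and "H \<subseteq> I" and \<iota>: "\<And>j. j \<in> {1..<n} \<Longrightarrow> \<iota> j \<in> I - H" "inj_on \<iota> {1..<n}"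
    and vu: "\<And>J. H \<subseteq> J \<Longrightarrow> v \<in> borel_measurable (PiM J (\<lambda>_. D))"
      "\<And>J. H \<subseteq> J \<Longrightarrow> u \<in> borel_measurable (PiM J (\<lambda>_. D))"
    and vu_cong: "\<And>p q. (\<And>j. j \<in> H \<Longrightarrow> p j = q j) \<Longrightarrow> v p = v q \<and> u p = u q"
    and v_in: "\<And>p. v p \<in> W" and "s > 0" "\<beta> > 0" and s: "2 * s * \<beta> * G\<^sup>2 \<le> 1"
  shows "(\<integral>\<^sup>+\<omega>. ennreal (exp (s * compensated_noise \<beta> (v (\<lambda>i. Y i \<omega>)) (u (\<lambda>i. Y i \<omega>))
            (\<lambda>j. Y (\<iota> j) \<omega>) n)) \<partial>M) \<le> 1"
  using \<iota>
proof (induction n)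
  case 0
  interpret M: prob_space M by fact
  show ?case by (simp add: compensated_noise_def M.emeasure_space_1)
next
  case (Suc n)
  interpret M: prob_space M by fact
  let ?E = "\<lambda>n \<omega>. ennreal (exp (s * compensated_noise \<beta> (v (\<lambda>i. Y i \<omega>)) (u (\<lambda>i. Y i \<omega>))
            (\<lambda>j. Y (\<iota> j) \<omega>) n))"
  have IH: "(\<integral>\<^sup>+\<omega>. ?E n \<omega> \<partial>M) \<le> 1"
  proof (rule Suc.IH)
    show "\<iota> j \<in> I - H" if "j \<in> {1..<n}" for j
      using Suc.prems(1)[of j] that by simp
    show "inj_on \<iota> {1..<n}"
      using Suc.prems(2) by (rule inj_on_subset) auto
  qed
  show ?case
  proof (cases "n = 0")
    case True
    then show ?thesis by (simp add: compensated_noise_def M.emeasure_space_1)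
  next
    case False
    \<comment> \<open>The iterate \<open>w p\<close> depends on the samples before step \<open>n\<close> only, all of which \<open>J\<close> indexes.\<close>
    define J where "J = H \<union> \<iota> ` {1..<n}"
    let ?N = "PiM J (\<lambda>_. D)"
    define past where "past \<omega> = restrict (\<lambda>i. Y i \<omega>) J" for \<omega>
    define a where "a p = ennreal (exp (s * compensated_noise \<beta> (v p) (u p) (\<lambda>j. p (\<iota> j)) n))" for p
    define w where "w p = inner_iterate W g \<beta> (v p) (\<lambda>j. p (\<iota> j)) n" for p
    define b where "b p x = ennreal (exp (s * (noise_term (u p) (w p) x
        - (norm (w p - u p))\<^sup>2 / (4 * \<beta>))))" for p x
    have n: "\<iota> n \<in> I" "\<iota> n \<notin> H"
      using Suc.prems(1)[of n] False by auto
    have "\<iota> n \<notin> \<iota> ` {1..<n}"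
      using inj_on_image_mem_iff[OF Suc.prems(2), of n "{1..<n}"] False by auto
    moreover have "J \<subseteq> I"
      using Suc.prems(1) \<open>H \<subseteq> I\<close> by (auto simp: J_def)
    ultimately have J: "J \<subseteq> I" "\<iota> n \<in> I" "\<iota> n \<notin> J"
      using n by (auto simp: J_def)
    have v: "v \<in> borel_measurable ?N" and u: "u \<in> borel_measurable ?N"
      using vu[of J] by (auto simp: J_def)
    have comp: "(\<lambda>p. p (\<iota> j)) \<in> measurable ?N D" if "j \<in> {1..<n}" for j
      using that by (intro measurable_component_singleton) (auto simp: J_def)
    have w: "w \<in> borel_measurable ?N"
      unfolding w_def by (rule measurable_inner_iterate[OF v comp])
    have a: "a \<in> borel_measurable ?N"
      unfolding a_def using measurable_compensated_noise[OF v u comp] by measurable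
    have b: "case_prod b \<in> borel_measurable (?N \<Otimes>\<^sub>M D)"
      unfolding b_def noise_term_def case_prod_beta'
    proof -
      note [measurable] = measurable_compose[OF measurable_fst w] measurable_compose[OF measurable_fst u]
        measurable_compose[OF _ measurable_mean_subgradient] measurable_g_compose
      show "(\<lambda>z. ennreal (exp (s * ((mean_subgradient (w (fst z)) - g (w (fst z)) (snd z))
          \<bullet> (w (fst z) - u (fst z)) - (norm (w (fst z) - u (fst z)))\<^sup>2 / (4 * \<beta>)))))
          \<in> borel_measurable (?N \<Otimes>\<^sub>M D)"
        by measurable
    qed
    have w_in: "w p \<in> W" for p
      unfolding w_def using inner_iterate_in closed_W v_in by blast
    have b_le: "(\<integral>\<^sup>+x. b p x \<partial>D) \<le> 1" for p
      unfolding b_def by (rule nn_integral_exp_noise_le_1[OF w_in \<open>s > 0\<close> \<open>\<beta> > 0\<close> s])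
    have "v (past \<omega>) = v (\<lambda>i. Y i \<omega>) \<and> u (past \<omega>) = u (\<lambda>i. Y i \<omega>)" for \<omega>
      by (rule vu_cong) (simp add: past_def J_def)
    then have past_eq: "v (past \<omega>) = v (\<lambda>i. Y i \<omega>)" "u (past \<omega>) = u (\<lambda>i. Y i \<omega>)" for \<omega>
      by simp_all
    have w_eq: "w (past \<omega>) = inner_iterate W g \<beta> (v (\<lambda>i. Y i \<omega>)) (\<lambda>j. Y (\<iota> j) \<omega>) n" for \<omega>
      unfolding w_def past_eq by (rule inner_iterate_cong) (auto simp: past_def J_def)
    have a_eq: "a (past \<omega>) = ?E n \<omega>" for \<omega>
    proof -
      have "compensated_noise \<beta> (v (\<lambda>i. Y i \<omega>)) (u (\<lambda>i. Y i \<omega>)) (\<lambda>j. past \<omega> (\<iota> j)) n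
          = compensated_noise \<beta> (v (\<lambda>i. Y i \<omega>)) (u (\<lambda>i. Y i \<omega>)) (\<lambda>j. Y (\<iota> j) \<omega>) n"
        by (rule compensated_noise_cong) (auto simp: past_def J_def)
      then show ?thesis
        by (simp add: a_def past_eq)
    qed
    have "?E (Suc n) \<omega> = a (past \<omega>) * b (past \<omega>) (Y (\<iota> n) \<omega>)" for \<omega>
      unfolding a_eq b_def w_eq past_eq using False
      by (simp add: compensated_noise_def Let_def distrib_left exp_add flip: ennreal_mult)
    then have "(\<integral>\<^sup>+\<omega>. ?E (Suc n) \<omega> \<partial>M) = (\<integral>\<^sup>+\<omega>. a (past \<omega>) * b (past \<omega>) (Y (\<iota> n) \<omega>) \<partial>M)"
      by simp
    also have "\<dots> \<le> (\<integral>\<^sup>+\<omega>. a (past \<omega>) \<partial>M)"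
      unfolding past_def
      by (rule M.nn_integral_fresh_sample_le[OF indep J distr[OF J(2)] a b b_le])
    also have "\<dots> \<le> 1"
      unfolding a_eq by (rule IH)
    finally show ?thesis .
  qed
qed

end

section \<open>The stages of a run\<close>

lemma assg_r_cong:
  assumes "\<And>k \<tau>. k \<in> {1..m} \<Longrightarrow> \<tau> \<in> {1..<t} \<Longrightarrow> x k \<tau> = y k \<tau>"
  shows "assg_r W g t \<beta>1 w0 x m = assg_r W g t \<beta>1 w0 y m"
  using assms
proof (induction m)
  case (Suc m)
  then have "assg_r W g t \<beta>1 w0 x m = assg_r W g t \<beta>1 w0 y m"
    by simp
  moreover have "inner_iterate W g \<beta> v (x (Suc m)) \<tau> = inner_iterate W g \<beta> v (y (Suc m)) \<tau>"
    if "\<tau> \<in> {1..t}" for \<beta> v \<tau>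
    using that Suc.prems by (intro inner_iterate_cong) auto
  ultimately show ?case by simp
qed simp

context bounded_subgradient_problem
begin

lemma assg_r_in:
  assumes "w0 \<in> W" "t \<ge> 1"
  shows "assg_r W g t \<beta>1 w0 x m \<in> W"
proof (induction m)
  case (Suc m)
  have "(\<Sum>\<tau>=1..t. (1 / real t) *\<^sub>R inner_iterate W g (\<beta>1 / 2 ^ m) (assg_r W g t \<beta>1 w0 x m) (x (Suc m)) \<tau>)
      \<in> W"
    using \<open>t \<ge> 1\<close> inner_iterate_in[OF closed_W Suc] by (intro convex_sum convex_W) auto
  then show ?case
    by (simp add: scaleR_sum_right)
qed (use assms in simp)

lemma measurable_assg_r:
  assumes "\<And>k \<tau>. k \<in> {1..m} \<Longrightarrow> \<tau> \<in> {1..<t} \<Longrightarrow> X k \<tau> \<in> measurable N D"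
  shows "(\<lambda>p. assg_r W g t \<beta>1 w0 (\<lambda>k \<tau>. X k \<tau> p) m) \<in> borel_measurable N"
  using assms
proof (induction m)
  case (Suc m)
  then have IH: "(\<lambda>p. assg_r W g t \<beta>1 w0 (\<lambda>k \<tau>. X k \<tau> p) m) \<in> borel_measurable N"
    by simp
  have "(\<lambda>p. inner_iterate W g (\<beta>1 / 2 ^ m) (assg_r W g t \<beta>1 w0 (\<lambda>k \<tau>. X k \<tau> p) m)
      (\<lambda>\<tau>. X (Suc m) \<tau> p) \<tau>) \<in> borel_measurable N" if "\<tau> \<in> {1..t}" for \<tau>
    using Suc.prems that by (intro measurable_inner_iterate[OF IH]) auto
  then show ?case
    by (simp add: borel_measurable_sum borel_measurable_scaleR)
qed simp

end

text \<open>The least admissible stage length exists because the right-hand side of its defining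
  inequality grows only logarithmically in \<open>t\<close>.\<close>

lemma stage_length_ge:
  fixes G e \<beta> \<delta>' :: real
  assumes "\<delta>' > 0"
  defines "t \<equiv> stage_length G e \<beta> \<delta>'"
  shows "real t \<ge> max 3 (136 * \<beta> * G\<^sup>2 * (1 + ln (4 * ln (real t) / \<delta>') + ln (real t)) / e)"
proof -
  define a where "a = 136 * \<beta> * G\<^sup>2 / e"
  have "((\<lambda>x. (1 + ln (4 * ln x / \<delta>') + ln x) / x) \<longlongrightarrow> 0) at_top"
    using \<open>\<delta>' > 0\<close> by real_asymp
  then have "((\<lambda>x. a * ((1 + ln (4 * ln x / \<delta>') + ln x) / x)) \<longlongrightarrow> a * 0) at_top"
    by (rule tendsto_mult_left)
  then have "\<forall>\<^sub>F x in at_top. a * ((1 + ln (4 * ln x / \<delta>') + ln x) / x) < 1"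
    by (rule order_tendstoD) simp
  then have "\<forall>\<^sub>F n in sequentially.
      a * ((1 + ln (4 * ln (real n) / \<delta>') + ln (real n)) / real n) < 1"
    using filterlim_real_sequentially by (rule eventually_compose_filterlim)
  moreover have "\<forall>\<^sub>F n in sequentially. n \<ge> 3"
    by (rule eventually_ge_at_top)
  ultimately have "\<forall>\<^sub>F n in sequentially. real n \<ge>
      max 3 (136 * \<beta> * G\<^sup>2 * (1 + ln (4 * ln (real n) / \<delta>') + ln (real n)) / e)"
  proof eventually_elim
    case (elim n)
    then have "a * (1 + ln (4 * ln (real n) / \<delta>') + ln (real n)) / real n < 1"
      by simp
    then have "a * (1 + ln (4 * ln (real n) / \<delta>') + ln (real n)) < real n"
      using elim by (subst (asm) pos_divide_less_eq) auto
    with elim show ?case by (simp add: a_def)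
  qed
  then have "\<exists>n::nat. real n \<ge>
      max 3 (136 * \<beta> * G\<^sup>2 * (1 + ln (4 * ln (real n) / \<delta>') + ln (real n)) / e)"
    by (rule eventually_happens'[OF sequentially_bot])
  then show ?thesis
    unfolding t_def stage_length_def by (rule LeastI_ex)
qed

sublocale assg_r_setting \<subseteq> error_bound_problem D W f g G \<epsilon> c \<theta>
  using subgradient_bound \<epsilon>_pos c_pos local_error_bound
  by unfold_locales (simp_all add: F_eq)

context assg_r_setting
begin

lemma \<epsilon>0_gt:
  assumes "K \<ge> 1"
  shows "\<epsilon>0 > \<epsilon>"
proof (rule ccontr)
  assume "\<not> \<epsilon>0 > \<epsilon>"
  then have "log 2 (\<epsilon>0 / \<epsilon>) \<le> 0"
    using \<epsilon>0_nonneg \<epsilon>_pos by (cases "\<epsilon>0 = 0") (auto simp: divide_simps log_def)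
  with assms show False
    by (simp add: K_eq num_stages_def)
qed

lemma final_gap_le: "\<epsilon>0 / 2 ^ K \<le> \<epsilon>"
proof (cases "\<epsilon>0 = 0")
  case False
  then have "\<epsilon>0 / \<epsilon> > 0"
    using \<epsilon>0_nonneg \<epsilon>_pos by simp
  moreover have "log 2 (\<epsilon>0 / \<epsilon>) \<le> real K"
    unfolding K_eq num_stages_def by linarith
  ultimately have "\<epsilon>0 / \<epsilon> \<le> 2 powr real K"
    by (simp add: log_le_iff)
  then show ?thesis
    using \<epsilon>_pos by (simp add: powr_realpow divide_simps mult.commute)
qed (use \<epsilon>_pos in simp)

lemma failure_share_pos: "K \<ge> 1 \<Longrightarrow> \<delta> / real K > 0"
  and failure_share_less_1: "K \<ge> 1 \<Longrightarrow> \<delta> / real K < 1"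
proof -
  have "\<delta> < 1"
    using \<delta>_less exp_gt_one[of "1::real"] by (smt (verit) divide_less_eq_1)
  then show "K \<ge> 1 \<Longrightarrow> \<delta> / real K > 0" "K \<ge> 1 \<Longrightarrow> \<delta> / real K < 1"
    using \<delta>_pos by (auto simp: divide_simps)
qed

lemma t_ge_3: "K \<ge> 1 \<Longrightarrow> t \<ge> 3"
  using stage_length_ge[OF failure_share_pos, where G = G and \<beta> = \<beta>1 and e = \<epsilon>0] by (simp add: t_eq)

text \<open>The defining inequality of the stage length is split into what the deterministic error and
  what the deviation of the noise require.\<close>

lemma stage_length_pays:
  assumes "K \<ge> 1"
  shows "34 * \<beta>1 * G\<^sup>2 * (1 + ln (real t)) \<le> real t * \<epsilon>0 / 4"
    and "34 * \<beta>1 * G\<^sup>2 * ln (real K / \<delta>) \<le> real t * \<epsilon>0 / 4"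
    and "\<beta>1 > 0"
proof -
  have \<epsilon>0: "\<epsilon>0 > 0"
    using \<epsilon>0_gt[OF assms] \<epsilon>_pos by simp
  then have "0 < 2 * c\<^sup>2 * \<epsilon>0 / \<epsilon> powr (2 * (1 - \<theta>))"
    using c_pos \<epsilon>_pos by simp
  with \<beta>1_ge show \<beta>1: "\<beta>1 > 0"
    by linarith
  \<comment> \<open>Since \<open>t \<ge> 3\<close>, the double logarithm in the stage length is not negative.\<close>
  have "exp 1 \<le> real t"
    using exp_le t_ge_3[OF assms] by linarith
  then have ln_t: "ln (real t) \<ge> 1"
    using t_ge_3[OF assms] by (subst ln_ge_iff) auto
  have "ln (real K / \<delta>) = ln (1 / (\<delta> / real K))"
    by simp
  also have "\<dots> \<le> ln (4 * ln (real t) / (\<delta> / real K))"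
    using ln_t failure_share_pos[OF assms] assms \<delta>_pos by (intro ln_mono divide_right_mono) auto
  finally have log_K: "ln (real K / \<delta>) \<le> ln (4 * ln (real t) / (\<delta> / real K))" .
  have "0 < ln (real K / \<delta>)"
    using failure_share_less_1[OF assms] failure_share_pos[OF assms] assms \<delta>_pos
    by (intro ln_gt_zero) (simp add: divide_simps)
  let ?L = "1 + ln (4 * ln (real t) / (\<delta> / real K)) + ln (real t)"
  have "136 * \<beta>1 * G\<^sup>2 * ?L / \<epsilon>0 \<le> real t"
    using stage_length_ge[OF failure_share_pos[OF assms], where G = G and \<beta> = \<beta>1 and e = \<epsilon>0] by (simp add: t_eq)
  then have L: "34 * \<beta>1 * G\<^sup>2 * ?L \<le> real t * \<epsilon>0 / 4"
    using \<epsilon>0 by (simp add: pos_divide_le_eq)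
  have "34 * \<beta>1 * G\<^sup>2 * l \<le> real t * \<epsilon>0 / 4" if "l \<le> ?L" for l
    by (rule order.trans[OF mult_left_mono[OF that] L]) (use \<beta>1 in simp)
  then show "34 * \<beta>1 * G\<^sup>2 * (1 + ln (real t)) \<le> real t * \<epsilon>0 / 4"
    "34 * \<beta>1 * G\<^sup>2 * ln (real K / \<delta>) \<le> real t * \<epsilon>0 / 4"
    using log_K ln_t \<open>0 < ln (real K / \<delta>)\<close> by simp_all
qed

definition stage_start :: "(nat \<Rightarrow> nat \<Rightarrow> 's) \<Rightarrow> nat \<Rightarrow> 'a" where
  "stage_start x k = assg_r W g t \<beta>1 w0 x k"

text \<open>A stage is compared with the nearest \<open>\<epsilon>\<close>-optimal point, not with a minimiser: the distance to
  the \<open>\<epsilon>\<close>-optimal points is linear in the gap, the one to the minimisers need not be.\<close>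

definition comparator :: "'a \<Rightarrow> 'a" where
  "comparator = closest_point (sublevel F W \<epsilon>)"

definition stage_noise :: "(nat \<Rightarrow> nat \<Rightarrow> 's) \<Rightarrow> nat \<Rightarrow> real" where
  "stage_noise x k = compensated_noise (\<beta>1 / 2 ^ k) (stage_start x k)
     (comparator (stage_start x k)) (x (Suc k)) t"

text \<open>Halving \<open>\<beta>\<close> keeps pace with the halving of the gap. With \<open>d = \<epsilon>0 / 2\<^sup>k\<close>, the distance to the
  comparator contributes \<open>d / 4\<close> to the new gap, and the deterministic error and the noise
  \<open>d / 8\<close> each.\<close>

lemma stage_halves_gap:
  assumes "K \<ge> 1" and x: "\<And>j. j \<in> {1..<t} \<Longrightarrow> x (Suc k) j \<in> space D"
    and gap: "F (stage_start x k) - optimal_value F W \<le> \<epsilon> + \<epsilon>0 / 2 ^ k"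
    and noise: "stage_noise x k \<le> real t * (\<epsilon>0 / 2 ^ k) / 8"
  shows "F (stage_start x (Suc k)) - optimal_value F W \<le> \<epsilon> + \<epsilon>0 / 2 ^ Suc k"
proof -
  define v where "v = stage_start x k"
  define u where "u = comparator v"
  define \<beta> where "\<beta> = \<beta>1 / 2 ^ k"
  define d where "d = \<epsilon>0 / 2 ^ k"
  have t: "t \<ge> 1"
    using t_ge_3 \<open>K \<ge> 1\<close> by linarith
  have "\<beta> > 0"
    using stage_length_pays(3)[OF \<open>K \<ge> 1\<close>] by (simp add: \<beta>_def)
  have d: "d > 0"
    using \<epsilon>0_gt[OF \<open>K \<ge> 1\<close>] \<epsilon>_pos by (simp add: d_def)
  have v: "v \<in> W"
    unfolding v_def stage_start_def using assg_r_in w0_in_W t by blast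
  have "u \<in> sublevel F W \<epsilon>"
    unfolding u_def comparator_def unfolding F_eq
    using closed_sublevel sublevel_nonempty \<epsilon>_pos by (intro closest_point_in_set) auto
  then have u: "u \<in> W" "F u \<le> optimal_value F W + \<epsilon>"
    by (auto simp: sublevel_def)
  have "norm (v - u) \<le> c * \<epsilon> powr (\<theta> - 1) * d"
    using dist_sublevel_le[OF v, of d] gap d
    unfolding u_def comparator_def unfolding F_eq by (simp add: v_def d_def)
  then have "(norm (u - v))\<^sup>2 \<le> (c * \<epsilon> powr (\<theta> - 1) * d)\<^sup>2"
    by (intro power_mono) (simp_all add: norm_minus_commute)
  also have "(\<epsilon> powr (\<theta> - 1))\<^sup>2 = 1 / \<epsilon> powr (2 * (1 - \<theta>))"
    using \<epsilon>_pos
    by (simp add: power2_eq_square powr_minus_divide[symmetric] algebra_simps flip: powr_add)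
  then have "(c * \<epsilon> powr (\<theta> - 1) * d)\<^sup>2 = d / 2 * (2 * c\<^sup>2 * d / \<epsilon> powr (2 * (1 - \<theta>)))"
    unfolding power_mult_distrib by (simp add: power2_eq_square)
  also have "\<dots> \<le> d / 2 * \<beta>"
    using divide_right_mono[OF \<beta>1_ge, of "2 ^ k"] d
    by (intro mult_left_mono) (simp_all add: \<beta>_def d_def ac_simps)
  finally have "(norm (u - v))\<^sup>2 / (2 * \<beta>) \<le> d / 4"
    using \<open>\<beta> > 0\<close> by (simp add: divide_simps mult.commute)
  then have dist: "real t * ((norm (u - v))\<^sup>2 / (2 * \<beta>)) \<le> real t * (d / 4)"
    by (intro mult_left_mono) auto
  have "34 * \<beta>1 * G\<^sup>2 * (1 + ln (real t)) / 2 ^ k \<le> real t * \<epsilon>0 / 4 / 2 ^ k"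
    by (intro divide_right_mono stage_length_pays \<open>K \<ge> 1\<close>) simp
  then have "34 * (\<beta> * G\<^sup>2 * (1 + ln (real t))) \<le> real t * d / 4"
    by (simp add: \<beta>_def d_def)
  moreover have "\<beta> * G\<^sup>2 * (1 + ln (real t)) \<ge> 0"
    using \<open>\<beta> > 0\<close> t by simp
  ultimately have det: "9 * \<beta> * G\<^sup>2 * (1 + ln (real t)) \<le> real t * d / 8"
    by linarith
  have next_start: "stage_start x (Suc k)
      = (1 / real t) *\<^sub>R (\<Sum>\<tau>=1..t. inner_iterate W g \<beta> v (x (Suc k)) \<tau>)"
    by (simp add: stage_start_def v_def \<beta>_def)
  have noise_eq: "stage_noise x k = compensated_noise \<beta> v u (x (Suc k)) t"
    by (simp add: stage_noise_def v_def u_def \<beta>_def)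
  have "real t * (F (stage_start x (Suc k)) - F u)
      \<le> real t * ((norm (u - v))\<^sup>2 / (2 * \<beta>)) + 9 * \<beta> * G\<^sup>2 * (1 + ln (real t)) + stage_noise x k"
    unfolding next_start noise_eq unfolding F_eq
    by (rule stage_average_le[OF v u(1) \<open>\<beta> > 0\<close> t x])
  also have "\<dots> \<le> real t * (d / 4) + real t * d / 8 + real t * d / 8"
    using dist det noise[folded d_def] by linarith
  also have "\<dots> = real t * (d / 2)"
    by simp
  finally have "F (stage_start x (Suc k)) - F u \<le> d / 2"
    using t by simp
  with u(2) show ?thesis
    by (simp add: d_def)
qed

abbreviation sample_path :: "'m \<Rightarrow> nat \<Rightarrow> nat \<Rightarrow> 's" where
  "sample_path \<omega> \<equiv> \<lambda>k \<tau>. \<xi> k \<tau> \<omega>"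

lemma measurable_samples: "k \<in> {1..K} \<Longrightarrow> \<tau> \<in> {1..<t} \<Longrightarrow> \<xi> k \<tau> \<in> measurable M D"
  using indep_samples unfolding samples.indep_vars_def2 by auto

lemma measurable_comparator: "comparator \<in> borel_measurable borel"
  unfolding comparator_def unfolding F_eq using closed_sublevel convex_sublevel sublevel_nonempty \<epsilon>_pos
  by (intro borel_measurable_continuous_onI continuous_on_closest_point) auto

lemma measurable_stage_start:
  assumes "\<And>i \<tau>. i \<in> {1..k} \<Longrightarrow> \<tau> \<in> {1..<t} \<Longrightarrow> X i \<tau> \<in> measurable N D"
  shows "(\<lambda>p. stage_start (\<lambda>i \<tau>. X i \<tau> p) k) \<in> borel_measurable N"
  unfolding stage_start_def using assms by (rule measurable_assg_r)

lemma measurable_stage_noise: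
  assumes "k < K"
  shows "(\<lambda>\<omega>. stage_noise (sample_path \<omega>) k) \<in> borel_measurable M"
proof -
  have start: "(\<lambda>\<omega>. stage_start (sample_path \<omega>) k) \<in> borel_measurable M"
    using assms by (intro measurable_stage_start measurable_samples) auto
  show ?thesis
    unfolding stage_noise_def using assms
    by (intro measurable_compensated_noise[OF start measurable_compose[OF start measurable_comparator]]
        measurable_samples) auto
qed

text \<open>Chernoff's bound, with the exponent \<open>s\<close> for which it gives exactly \<open>\<delta> / K\<close>. The length of a
  stage makes this \<open>s\<close> small enough for the exponential moment to be at most 1.\<close>

lemma prob_stage_noise_large:
  assumes "k < K"
  shows "samples.prob {\<omega> \<in> space M. stage_noise (sample_path \<omega>) k \<ge> real t * (\<epsilon>0 / 2 ^ k) / 8}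
    \<le> \<delta> / real K"
proof -
  have K: "K \<ge> 1"
    using assms by simp
  define a where "a = real t * (\<epsilon>0 / 2 ^ k) / 8"
  define s where "s = ln (real K / \<delta>) / a"
  define Y where "Y = (\<lambda>(k, \<tau>). \<xi> k \<tau>)"
  define v where "v p = stage_start (\<lambda>i \<tau>. p (i, \<tau>)) k" for p
  define H where "H = {1..k} \<times> {1..<t}"
  have "a > 0"
    using \<epsilon>0_gt[OF K] \<epsilon>_pos t_ge_3[OF K] by (simp add: a_def)
  have log_pos: "ln (real K / \<delta>) > 0"
    using failure_share_less_1[OF K] failure_share_pos[OF K] K \<delta>_pos
    by (intro ln_gt_zero) (simp add: divide_simps)
  then have "s > 0"
    using \<open>a > 0\<close> by (simp add: s_def)
  have \<beta>: "\<beta>1 / 2 ^ k > 0"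
    using stage_length_pays(3)[OF K] by simp
  have "34 * \<beta>1 * G\<^sup>2 * ln (real K / \<delta>) / 2 ^ k \<le> real t * \<epsilon>0 / 4 / 2 ^ k"
    by (intro divide_right_mono stage_length_pays K) simp
  then have "17 * (\<beta>1 / 2 ^ k * G\<^sup>2 * ln (real K / \<delta>)) \<le> a"
    by (simp add: a_def)
  moreover have "\<beta>1 / 2 ^ k * G\<^sup>2 * ln (real K / \<delta>) \<ge> 0"
    using \<beta> log_pos by (intro mult_nonneg_nonneg) auto
  ultimately have "2 * (\<beta>1 / 2 ^ k * G\<^sup>2 * ln (real K / \<delta>)) \<le> a"
    by linarith
  then have s_le: "2 * s * (\<beta>1 / 2 ^ k) * G\<^sup>2 \<le> 1"
    using \<open>a > 0\<close> by (simp add: s_def divide_simps ac_simps)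
  have t: "t \<ge> 1"
    using t_ge_3[OF K] by simp
  have v_meas: "v \<in> borel_measurable (PiM J (\<lambda>_. D))" if "H \<subseteq> J" for J
    unfolding v_def using that
    by (intro measurable_stage_start measurable_component_singleton) (auto simp: H_def)
  have v_cong: "v p = v q" if "\<And>j. j \<in> H \<Longrightarrow> p j = q j" for p q
    unfolding v_def stage_start_def using that by (intro assg_r_cong) (auto simp: H_def)
  have "(\<integral>\<^sup>+\<omega>. ennreal (exp (s * compensated_noise (\<beta>1 / 2 ^ k) (v (\<lambda>i. Y i \<omega>))
      (comparator (v (\<lambda>i. Y i \<omega>))) (\<lambda>j. Y (Suc k, j) \<omega>) t)) \<partial>M) \<le> 1"
  proof (rule nn_integral_exp_compensated_noise_le_1[where I = "{1..K} \<times> {1..<t}" and H = H])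
    show "prob_space.indep_vars M (\<lambda>_. D) Y ({1..K} \<times> {1..<t})"
      unfolding Y_def by (rule indep_samples)
    show "distr M D (Y i) = D" if "i \<in> {1..K} \<times> {1..<t}" for i
      using that distr_samples by (auto simp: Y_def)
    show "v p \<in> W" for p
      unfolding v_def stage_start_def using assg_r_in w0_in_W t by blast
    show "(\<lambda>p. comparator (v p)) \<in> borel_measurable (PiM J (\<lambda>_. D))" if "H \<subseteq> J" for J
      using measurable_compose[OF v_meas[OF that] measurable_comparator] .
    show "v p = v q \<and> comparator (v p) = comparator (v q)" if "\<And>j. j \<in> H \<Longrightarrow> p j = q j" for p q
      using v_cong[OF that] by simp
  qed (use assms v_meas \<open>s > 0\<close> \<beta> s_le samples.prob_space_axioms in
      \<open>auto simp: H_def inj_on_def\<close>)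
  then have moment: "(\<integral>\<^sup>+\<omega>. ennreal (exp (s * stage_noise (sample_path \<omega>) k)) \<partial>M) \<le> 1"
    by (simp add: stage_noise_def v_def Y_def)
  have "emeasure M {\<omega> \<in> space M. stage_noise (sample_path \<omega>) k \<ge> a}
      \<le> ennreal (exp (- s * a)) *
        (\<integral>\<^sup>+\<omega>. ennreal (exp (s * stage_noise (sample_path \<omega>) k)) * indicator (space M) \<omega> \<partial>M)"
    using measurable_stage_noise[OF assms] \<open>s > 0\<close> by (intro Chernoff_ineq_nn_integral_ge) auto
  also have "\<dots> = ennreal (exp (- s * a)) *
        (\<integral>\<^sup>+\<omega>. ennreal (exp (s * stage_noise (sample_path \<omega>) k)) \<partial>M)"
    by (intro arg_cong2[where f = "(*)"] nn_integral_cong) auto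
  also have "\<dots> \<le> ennreal (exp (- s * a))"
    using mult_left_mono[OF moment, of "ennreal (exp (- s * a))"] by simp
  also have "exp (- s * a) = \<delta> / real K"
    using \<open>a > 0\<close> K \<delta>_pos by (simp add: s_def exp_minus)
  finally show ?thesis
    using \<delta>_pos unfolding a_def samples.emeasure_eq_measure by simp
qed

text \<open>Outside the union of the \<open>K\<close> failure events every stage halves the bound on the gap in excess
  of \<open>\<epsilon>\<close>, and \<open>K\<close> halvings bring \<open>\<epsilon>0\<close> below \<open>\<epsilon>\<close>.\<close>

lemma prob_final_gap_ge:
  "samples.prob {\<omega> \<in> space M. F (stage_start (sample_path \<omega>) K) - optimal_value F W \<le> 2 * \<epsilon>} \<ge> 1 - \<delta>"
proof (cases "K = 0")
  case True
  then have "F w0 - optimal_value F W \<le> 2 * \<epsilon>"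
    using initial_gap final_gap_le \<epsilon>_pos by simp
  then show ?thesis
    using True \<delta>_pos by (simp add: stage_start_def samples.prob_space)
next
  case False
  then have K: "K \<ge> 1" by simp
  define bad where "bad k = {\<omega> \<in> space M. stage_noise (sample_path \<omega>) k \<ge> real t * (\<epsilon>0 / 2 ^ k) / 8}"
    for k
  let ?good = "{\<omega> \<in> space M. F (stage_start (sample_path \<omega>) K) - optimal_value F W \<le> 2 * \<epsilon>}"
  have t: "t \<ge> 1"
    using t_ge_3[OF K] by simp
  have bad_sets: "bad k \<in> samples.events" if "k < K" for k
    unfolding bad_def using measurable_stage_noise[OF that] by measurable
  \<comment> \<open>The output lies in \<open>W\<close>, where the loss is known to be continuous.\<close>
  have good_sets: "?good \<in> samples.events"
  proof -
    have "?good = (\<lambda>\<omega>. stage_start (sample_path \<omega>) K) -` sublevel F W (2 * \<epsilon>) \<inter> space M"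
      using assg_r_in[OF w0_in_W t] by (auto simp: sublevel_def stage_start_def)
    moreover have "(\<lambda>\<omega>. stage_start (sample_path \<omega>) K) \<in> borel_measurable M"
      by (intro measurable_stage_start measurable_samples)
    ultimately show ?thesis
      using closed_sublevel by (simp add: F_eq measurable_sets borel_closed)
  qed
  have "\<omega> \<in> ?good" if \<omega>: "\<omega> \<in> space M" "\<omega> \<notin> (\<Union>k<K. bad k)" for \<omega>
  proof -
    have "F (stage_start (sample_path \<omega>) k) - optimal_value F W \<le> \<epsilon> + \<epsilon>0 / 2 ^ k" if "k \<le> K" for k
      using that
    proof (induction k)
      case 0
      then show ?case
        using initial_gap \<epsilon>_pos by (simp add: stage_start_def)
    next
      case (Suc k)
      show ?case
      proof (rule stage_halves_gap[OF K])
        show "sample_path \<omega> (Suc k) j \<in> space D" if "j \<in> {1..<t}" for j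
          using measurable_space[OF measurable_samples] Suc.prems that \<omega>(1) by simp
        show "stage_noise (sample_path \<omega>) k \<le> real t * (\<epsilon>0 / 2 ^ k) / 8"
          using \<omega> Suc.prems by (auto simp: bad_def not_le intro: less_imp_le)
      qed (use Suc in simp)
    qed
    from this[of K] show ?thesis
      using final_gap_le \<omega>(1) by simp
  qed
  then have "space M - (\<Union>k<K. bad k) \<subseteq> ?good"
    by blast
  then have "samples.prob (space M - (\<Union>k<K. bad k)) \<le> samples.prob ?good"
    using good_sets by (rule samples.finite_measure_mono)
  moreover have "samples.prob (space M - (\<Union>k<K. bad k)) = 1 - samples.prob (\<Union>k<K. bad k)"
    using bad_sets by (intro samples.prob_compl) auto
  moreover have "samples.prob (\<Union>k<K. bad k) \<le> (\<Sum>k<K. samples.prob (bad k))"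
    using bad_sets by (intro samples.finite_measure_subadditive_finite) auto
  moreover have "(\<Sum>k<K. samples.prob (bad k)) \<le> (\<Sum>k<K. \<delta> / real K)"
    unfolding bad_def using prob_stage_noise_large by (intro sum_mono) auto
  moreover have "(\<Sum>k<K. \<delta> / real K) = \<delta>"
    using K by simp
  ultimately show ?thesis
    by linarith
qed

end

section \<open>The number of iterations\<close>

text \<open>A multiple of \<open>Q y\<close> satisfies the inequality that defines the stage length, because its
  logarithm is in turn at most a multiple of \<open>y\<close>. The last premise on \<open>C\<close> closes this circle.\<close>

lemma stage_length_le:
  fixes a b C Q y G e \<beta> \<delta>' :: real
  assumes "Q \<ge> 1" "y \<ge> 1" and Q: "ln Q \<le> y" and "\<delta>' > 0" and \<delta>': "ln (1 / \<delta>') \<le> y"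
    and a: "0 \<le> 136 * \<beta> * G\<^sup>2 / e" "136 * \<beta> * G\<^sup>2 / e \<le> a * Q"
    and "C \<ge> 3" and C: "a * (9 + 2 * ln (2 * C)) \<le> C"
  shows "real (stage_length G e \<beta> \<delta>') \<le> 2 * C * Q * y"
proof -
  define N where "N = C * Q * y"
  define n where "n = nat \<lceil>N\<rceil>"
  have "1 \<le> Q * y"
    using mult_mono[of 1 Q 1 y] assms by simp
  then have N: "N \<ge> 3"
    using mult_mono[of 3 C 1 "Q * y"] \<open>C \<ge> 3\<close> by (simp add: N_def mult.assoc)
  then have n: "N \<le> real n" "real n \<le> 2 * N" "real n \<ge> 3"
    unfolding n_def by linarith+
  have ln_C: "0 \<le> ln (2 * C)"
    using \<open>C \<ge> 3\<close> by simp
  have "ln (real n) \<le> ln (2 * C * Q * y)"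
    using n N by (intro ln_mono) (simp_all add: N_def)
  also have "\<dots> = ln (2 * C) + ln Q + ln y"
    using assms by (simp add: ln_mult)
  also have "\<dots> \<le> ln (2 * C) * y + y + y"
    using mult_left_mono[OF \<open>y \<ge> 1\<close> ln_C] ln_bound[of y] Q \<open>y \<ge> 1\<close> by simp
  finally have ln_n: "ln (real n) \<le> (ln (2 * C) + 2) * y"
    by (simp add: algebra_simps)
  have "ln (real n) > 0"
    using n by simp
  then have "ln (4 * ln (real n) / \<delta>') = ln 4 + ln (ln (real n)) + ln (1 / \<delta>')"
    using \<open>\<delta>' > 0\<close> by (simp add: ln_mult ln_div)
  also have "\<dots> \<le> 3 + ln (real n) + y"
    using ln_le_minus_one[of 4] ln_bound[OF \<open>ln (real n) > 0\<close>] \<delta>' by simp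
  finally have "1 + ln (4 * ln (real n) / \<delta>') + ln (real n) \<le> 4 * y + y + 2 * ((ln (2 * C) + 2) * y)"
    using ln_n \<open>y \<ge> 1\<close> by simp
  also have "\<dots> = (9 + 2 * ln (2 * C)) * y"
    by (simp add: algebra_simps)
  finally have "136 * \<beta> * G\<^sup>2 / e * (1 + ln (4 * ln (real n) / \<delta>') + ln (real n))
      \<le> 136 * \<beta> * G\<^sup>2 / e * ((9 + 2 * ln (2 * C)) * y)"
    using a(1) by (rule mult_left_mono)
  also have "\<dots> \<le> a * Q * ((9 + 2 * ln (2 * C)) * y)"
    using a(2) ln_C \<open>y \<ge> 1\<close> by (intro mult_right_mono) auto
  also have "\<dots> = a * (9 + 2 * ln (2 * C)) * (Q * y)"
    by (simp add: ac_simps)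
  also have "\<dots> \<le> C * (Q * y)"
    using C \<open>1 \<le> Q * y\<close> by (intro mult_right_mono) auto
  also have "\<dots> \<le> real n"
    using n by (simp add: N_def mult.assoc)
  finally have "stage_length G e \<beta> \<delta>' \<le> n"
    unfolding stage_length_def using n by (intro Least_le) simp
  then show ?thesis
    using n by (simp add: N_def)
qed

lemma complexity_constant_exists:
  fixes a :: real
  shows "\<exists>C\<ge>3. a * (9 + 2 * ln (2 * C)) \<le> C"
proof -
  have "((\<lambda>x::real. (9 + 2 * ln (2 * x)) / x) \<longlongrightarrow> 0) at_top"
    by real_asymp
  then have "((\<lambda>x. a * ((9 + 2 * ln (2 * x)) / x)) \<longlongrightarrow> a * 0) at_top"
    by (rule tendsto_mult_left)
  then have "\<forall>\<^sub>F x in at_top. a * ((9 + 2 * ln (2 * x)) / x) < 1"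
    by (rule order_tendstoD) simp
  then have "\<forall>\<^sub>F x in at_top. x \<ge> 3 \<and> a * (9 + 2 * ln (2 * x)) \<le> x"
    using eventually_ge_at_top[of 3]
  proof eventually_elim
    case (elim x)
    then have "a * (9 + 2 * ln (2 * x)) / x < 1"
      by simp
    then have "a * (9 + 2 * ln (2 * x)) < x"
      using elim by (subst (asm) pos_divide_less_eq) auto
    with elim show ?case by simp
  qed
  then show ?thesis
    using eventually_happens'[OF trivial_limit_at_top_linorder] by blast
qed

text \<open>For \<open>\<beta>1\<close> of the order of its lower bound, \<open>\<beta>1 G\<^sup>2 / \<epsilon>0\<close> is of the order of the condition number
  \<open>c\<^sup>2 G\<^sup>2 / \<epsilon> powr (2 (1 - \<theta>))\<close>. As the latter is at least 1, its logarithm is nonnegative, so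
  that \<open>y\<close> below dominates both \<open>ln Q\<close> and \<open>ln (K / \<delta>)\<close>.\<close>

lemma (in assg_r_setting) iterations_le:
  assumes "sublevel F W \<epsilon> \<noteq> W" and \<beta>1_le: "\<beta>1 \<le> b * (2 * c\<^sup>2 * \<epsilon>0 / \<epsilon> powr (2 * (1 - \<theta>)))"
    and "C \<ge> 3" and C: "272 * b * (9 + 2 * ln (2 * C)) \<le> C"
  shows "real (K * t) \<le> 2 * C * (c\<^sup>2 * G\<^sup>2 * real K * ln (1 / \<delta>) / \<epsilon> powr (2 * (1 - \<theta>))) *
    (1 + ln (real K * (c\<^sup>2 * G\<^sup>2 / \<epsilon> powr (2 * (1 - \<theta>)))) / ln (1 / \<delta>))"
proof (cases "K = 0")
  case False
  then have K: "K \<ge> 1" by simp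
  define P where "P = \<epsilon> powr (2 * (1 - \<theta>))"
  define Q where "Q = c\<^sup>2 * G\<^sup>2 / P"
  define y where "y = ln (1 / \<delta>) + ln (real K * Q)"
  have Q: "Q \<ge> 1"
    unfolding Q_def P_def using condition_number_ge_1 assms(1) by (simp add: F_eq)
  have "exp 1 < 1 / \<delta>"
    using \<delta>_less \<delta>_pos by (simp add: field_simps)
  then have log_\<delta>: "ln (1 / \<delta>) > 1"
    using ln_less_cancel_iff[of "exp 1" "1 / \<delta>"] \<delta>_pos by simp
  have ln_KQ: "ln (real K * Q) = ln (real K) + ln Q"
    using K Q by (simp add: ln_mult)
  have nonneg: "ln (real K) \<ge> 0" "ln Q \<ge> 0"
    using K Q by auto
  have "real t \<le> 2 * C * Q * y"
    unfolding t_eq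
  proof (rule stage_length_le)
    show "ln (1 / (\<delta> / real K)) \<le> y"
      using K \<delta>_pos nonneg by (simp add: y_def ln_KQ ln_div)
    show "0 \<le> 136 * \<beta>1 * G\<^sup>2 / \<epsilon>0"
      using stage_length_pays(3)[OF K] \<epsilon>0_nonneg by simp
    have "\<epsilon>0 > 0"
      using \<epsilon>0_gt[OF K] \<epsilon>_pos by simp
    then have "\<beta>1 / \<epsilon>0 \<le> 2 * b * c\<^sup>2 / P"
      using \<beta>1_le by (simp add: P_def pos_divide_le_eq ac_simps)
    then have "136 * G\<^sup>2 * (\<beta>1 / \<epsilon>0) \<le> 136 * G\<^sup>2 * (2 * b * c\<^sup>2 / P)"
      by (intro mult_left_mono) auto
    then show "136 * \<beta>1 * G\<^sup>2 / \<epsilon>0 \<le> 272 * b * Q"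
      by (simp add: Q_def ac_simps)
    show "y \<ge> 1" "ln Q \<le> y"
      using log_\<delta> nonneg unfolding y_def ln_KQ by linarith+
  qed (fact Q failure_share_pos[OF K] assms(3,4))+
  then have "real (K * t) \<le> real K * (2 * C * Q * y)"
    by (simp add: mult_left_mono)
  also have "\<dots> = 2 * C * (Q * real K * ln (1 / \<delta>)) * (1 + ln (real K * Q) / ln (1 / \<delta>))"
    using log_\<delta> by (simp add: y_def field_simps)
  also have "Q * real K * ln (1 / \<delta>) = c\<^sup>2 * G\<^sup>2 * real K * ln (1 / \<delta>) / P"
    by (simp add: Q_def)
  finally show ?thesis
    by (simp only: Q_def P_def)
qed simp

section \<open>The convergence theorem\<close>

theorem theorem7:
  shows "(\<forall>(M :: 'm measure) (D :: 's measure) (W :: 'a::euclidean_space set) f g w0 \<epsilon>0 G \<epsilon> c \<theta> \<delta> \<beta>1 \<xi> F K t.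
            assg_r_setting M D W f g w0 \<epsilon>0 G \<epsilon> c \<theta> \<delta> \<beta>1 \<xi> F K t \<longrightarrow>
            measure M {\<omega> \<in> space M.
              F (assg_r W g t \<beta>1 w0 (\<lambda>k \<tau>. \<xi> k \<tau> \<omega>) K) - optimal_value F W \<le> 2 * \<epsilon>} \<ge> 1 - \<delta>) \<and>
         (\<forall>B::real. \<exists>C>0.
          \<forall>(M :: 'm measure) (D :: 's measure) (W :: 'a set) f g w0 \<epsilon>0 G \<epsilon> c \<theta> \<delta> \<beta>1 \<xi> F K t.
            assg_r_setting M D W f g w0 \<epsilon>0 G \<epsilon> c \<theta> \<delta> \<beta>1 \<xi> F K t \<and>
            sublevel F W \<epsilon> \<noteq> W \<and>
            \<beta>1 \<le> B * (2 * c\<^sup>2 * \<epsilon>0 / \<epsilon> powr (2 * (1 - \<theta>))) \<longrightarrow>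
            real (K * t) \<le>
              C * (c\<^sup>2 * G\<^sup>2 * real K * ln (1 / \<delta>) / \<epsilon> powr (2 * (1 - \<theta>))) *
              (1 + ln (real K * (c\<^sup>2 * G\<^sup>2 / \<epsilon> powr (2 * (1 - \<theta>)))) / ln (1 / \<delta>)))"
proof (intro conjI allI impI)
  fix M :: "'m measure" and D :: "'s measure" and W :: "'a set"
    and f g w0 \<epsilon>0 G \<epsilon> c \<theta> \<delta> \<beta>1 \<xi> F K t
  assume "assg_r_setting M D W f g w0 \<epsilon>0 G \<epsilon> c \<theta> \<delta> \<beta>1 \<xi> F K t"
  then interpret assg_r_setting M D W f g w0 \<epsilon>0 G \<epsilon> c \<theta> \<delta> \<beta>1 \<xi> F K t .
  show "measure M {\<omega> \<in> space M.
      F (assg_r W g t \<beta>1 w0 (\<lambda>k \<tau>. \<xi> k \<tau> \<omega>) K) - optimal_value F W \<le> 2 * \<epsilon>} \<ge> 1 - \<delta>"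
    using prob_final_gap_ge unfolding stage_start_def .
next
  fix B :: real
  obtain C where C: "C \<ge> 3" "272 * B * (9 + 2 * ln (2 * C)) \<le> C"
    using complexity_constant_exists by blast
  show "\<exists>C>0. \<forall>(M :: 'm measure) (D :: 's measure) (W :: 'a set) f g w0 \<epsilon>0 G \<epsilon> c \<theta> \<delta> \<beta>1 \<xi> F K t.
      assg_r_setting M D W f g w0 \<epsilon>0 G \<epsilon> c \<theta> \<delta> \<beta>1 \<xi> F K t \<and>
      sublevel F W \<epsilon> \<noteq> W \<and>
      \<beta>1 \<le> B * (2 * c\<^sup>2 * \<epsilon>0 / \<epsilon> powr (2 * (1 - \<theta>))) \<longrightarrow>
      real (K * t) \<le>
        C * (c\<^sup>2 * G\<^sup>2 * real K * ln (1 / \<delta>) / \<epsilon> powr (2 * (1 - \<theta>))) *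
        (1 + ln (real K * (c\<^sup>2 * G\<^sup>2 / \<epsilon> powr (2 * (1 - \<theta>)))) / ln (1 / \<delta>))"
  proof (intro exI[of _ "2 * C"] conjI allI impI)
    show "0 < 2 * C"
      using C(1) by simp
  qed (elim conjE, rule assg_r_setting.iterations_le[OF _ _ _ C])
qed

end
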